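(* Let $d\ge1$, $m\ge0$, $K\ge1$ be integers, let $\varepsilon\in\{1,-1\}$, and let $a,b,c\in\mathbb{C}$ with $c\notin\{0,-1,-2,\ldots\}$. Write $m=d\ell+\rho$ with integers $\ell\ge0$ and $0\le\rho\le d-1$, and put $\lambda_\rho=\frac{\rho+1}{d}-1$. Assume that $j+\lambda_\rho+1-a\ne0$ and $j+\lambda_\rho+1-b\ne0$ for $1\le j\le\ell$. If $\varepsilon=1$, assume also $\operatorname{Re}(c-a-b)>-1$; if $\varepsilon=-1$, assume that the series appearing below (the left-hand side and $A^{(k)}_{0,\varepsilon}(\lambda_\rho;a,b,c)$ for $1\le k\le K$) converge. Then $$\sum_{n=0}^{\infty}\frac{\varepsilon^n(a)_n(b)_n}{(c)_n n!\,(dn+m+1)^K}=\frac{1}{d^K}\sum_{s=0}^{K-1}(-1)^s r_{\ell,s}^{[\lambda_\rho]}A_{0,\varepsilon}^{(K-s)}(\lambda_\rho;a,b,c)+\frac{(-1)^{K-1}}{d^K}\sum_{j=1}^{\ell}\ \sum_{u,v\ge0,\, u+v=K-1}t_{\ell,j,u}^{[\lambda_\rho]}\,e_{\varepsilon,j,v}^{[\lambda_\rho]}(a,b,c).$$ For $d=1$ one has $\lambda_\rho=0$, and the formula reduces to $$A_{m,\varepsilon}^{(K)}(a,b,c)=\sum_{s=0}^{K-1}(-1)^s r_{m,s}^{[0]}A_{0,\varepsilon}^{(K-s)}(0;a,b,c)+(-1)^{K-1}\sum_{j=1}^{m}\sum_{u,v\ge0,\, u+v=K-1}t^{[0]}_{m,j,u}e^{[0]}_{\varepsilon,j,v}(a,b,c),$$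 where $A^{(K)}_{m,\varepsilon}(a,b,c)=\sum_{n\ge0}\frac{\varepsilon^n(a)_n(b)_n}{(c)_nn!}\frac1{(n+m+1)^K}$.
   Context: Notation: $(u)_0=1$, $(u)_n=u(u+1)\cdots(u+n-1)$. For a complex shift $\lambda_0$, $$A_{0,\varepsilon}^{(K)}(\lambda_0;a,b,c)=\sum_{n=0}^{\infty}\frac{\varepsilon^n(a)_n(b)_n}{(c)_n n!\,(n+1+\lambda_0)^K}.$$ Define $$\mathcal R_\ell(\lambda)=\varepsilon^\ell\frac{(1+\lambda)_\ell(2-c+\lambda)_\ell}{(2-a+\lambda)_\ell(2-b+\lambda)_\ell}\quad(\mathcal R_0=1),$$ $$\mathcal T_{\ell,j}(\lambda)=\varepsilon^{\ell-j+1}\frac{(j+1+\lambda)_{\ell-j}(j+2-c+\lambda)_{\ell-j}}{(j+1-a+\lambda)_{\ell-j+1}(j+1-b+\lambda)_{\ell-j+1}}\quad(1\le j\le\ell).$$ For $\varepsilon=1$, $E_+(M;a,b,c)=\frac{\Gamma(c)\Gamma(c-a-b+1)}{\Gamma(c-a)\Gamma(c-b)}$ (independent of $M$; $1/\Gamma(z)=0$ at non-positive integers $z$), and for $\varepsilon=-1$, $$E_-(M;a,b,c)=(c+a+b-2M-2)\,{}_2F_1(a,b;c;-1)-2\left.\frac{d}{dz}{}_2F_1(a,b;c;z)\right|_{z=-1},$$ where ${}_2F_1(a,b;c;z)$ is the Gauss hypergeometric function, continued analytically to $\mathbb{C}\setminus[1,\infty)$ (principal branch). The coefficients are the Taylor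 coefficients at $t=0$ in $$\mathcal R_\ell(\lambda_\rho+t)=\sum_{s\ge0}r_{\ell,s}^{[\lambda_\rho]}t^s,\qquad \mathcal T_{\ell,j}(\lambda_\rho+t)=\sum_{s\ge0}t_{\ell,j,s}^{[\lambda_\rho]}t^s,\qquad E_\varepsilon(j+\lambda_\rho+t;a,b,c)=\sum_{v\ge0}e_{\varepsilon,j,v}^{[\lambda_\rho]}(a,b,c)t^v .$$ *)

theory Defs
  imports "HOL-Complex_Analysis.Complex_Analysis"
begin

definition hyp_coeff :: "complex \<Rightarrow> complex \<Rightarrow> complex \<Rightarrow> nat \<Rightarrow> complex" where
  "hyp_coeff a b c n =
     (pochhammer a n * pochhammer b n) / (pochhammer c n * fact n)"

text \<open>
  The Gauss function on the plane cut along \<open>[1,\<infinity>)\<close>: the holomorphic function there that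
  agrees with the hypergeometric series on the open unit disc. As the cut plane is
  connected, its values off the cut are uniquely determined; those on the cut are
  unspecified.
\<close>
definition hyp2F1 :: "complex \<Rightarrow> complex \<Rightarrow> complex \<Rightarrow> complex \<Rightarrow> complex" where
  "hyp2F1 a b c = (SOME f.
     f holomorphic_on (- (complex_of_real ` {1..})) \<and>
     (\<forall>z\<in>ball 0 1. (\<lambda>n. hyp_coeff a b c n * z ^ n) sums f z))"

definition A0_term ::
  "complex \<Rightarrow> nat \<Rightarrow> complex \<Rightarrow> complex \<Rightarrow> complex \<Rightarrow> complex \<Rightarrow> nat \<Rightarrow> complex" where
  "A0_term \<epsilon> K lam a b c n =
     \<epsilon> ^ n * hyp_coeff a b c n / (of_nat n + 1 + lam) ^ K"

definition A0 :: "complex \<Rightarrow> nat \<Rightarrow> complex \<Rightarrow> complex \<Rightarrow> complex \<Rightarrow> complex \<Rightarrow> complex" where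
  "A0 \<epsilon> K lam a b c = (\<Sum>n. A0_term \<epsilon> K lam a b c n)"

definition Am :: "complex \<Rightarrow> nat \<Rightarrow> nat \<Rightarrow> complex \<Rightarrow> complex \<Rightarrow> complex \<Rightarrow> complex" where
  "Am \<epsilon> K m a b c = (\<Sum>n. \<epsilon> ^ n * hyp_coeff a b c n / of_nat (n + m + 1) ^ K)"

definition Rfun ::
  "complex \<Rightarrow> complex \<Rightarrow> complex \<Rightarrow> complex \<Rightarrow> nat \<Rightarrow> complex \<Rightarrow> complex" where
  "Rfun \<epsilon> a b c l lam = \<epsilon> ^ l *
     (pochhammer (1 + lam) l * pochhammer (2 - c + lam) l) /
     (pochhammer (2 - a + lam) l * pochhammer (2 - b + lam) l)"

text \<open>Only used for \<open>1 \<le> j \<le> l\<close>, so the subtraction \<open>l - j\<close> is never truncated.\<close>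
definition Tfun ::
  "complex \<Rightarrow> complex \<Rightarrow> complex \<Rightarrow> complex \<Rightarrow> nat \<Rightarrow> nat \<Rightarrow> complex \<Rightarrow> complex" where
  "Tfun \<epsilon> a b c l j lam = \<epsilon> ^ (l - j + 1) *
     (pochhammer (of_nat j + 1 + lam) (l - j) *
      pochhammer (of_nat j + 2 - c + lam) (l - j)) /
     (pochhammer (of_nat j + 1 - a + lam) (l - j + 1) *
      pochhammer (of_nat j + 1 - b + lam) (l - j + 1))"

text \<open>\<open>rGamma\<close> is the entire function \<open>1/\<Gamma>\<close>, zero at the non-positive integers.\<close>
definition E_plus :: "complex \<Rightarrow> complex \<Rightarrow> complex \<Rightarrow> complex \<Rightarrow> complex" where
  "E_plus M a b c = Gamma c * Gamma (c - a - b + 1) * rGamma (c - a) * rGamma (c - b)"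

definition E_minus :: "complex \<Rightarrow> complex \<Rightarrow> complex \<Rightarrow> complex \<Rightarrow> complex" where
  "E_minus M a b c =
     (c + a + b - 2 * M - 2) * hyp2F1 a b c (-1) - 2 * deriv (hyp2F1 a b c) (-1)"

text \<open>The sign \<open>\<epsilon>\<close> only takes the values \<open>1\<close> and \<open>-1\<close>.\<close>
definition E_eps ::
  "complex \<Rightarrow> complex \<Rightarrow> complex \<Rightarrow> complex \<Rightarrow> complex \<Rightarrow> complex" where
  "E_eps \<epsilon> M a b c = (if \<epsilon> = 1 then E_plus M a b c else E_minus M a b c)"

definition taylor_coeff :: "(complex \<Rightarrow> complex) \<Rightarrow> nat \<Rightarrow> complex" where
  "taylor_coeff f s = fps_nth (fps_expansion f 0) s"

definition r_coeff ::
  "complex \<Rightarrow> complex \<Rightarrow> complex \<Rightarrow> complex \<Rightarrow> complex \<Rightarrow> nat \<Rightarrow> nat \<Rightarrow> complex" where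
  "r_coeff \<epsilon> a b c lam l s = taylor_coeff (\<lambda>t. Rfun \<epsilon> a b c l (lam + t)) s"

definition t_coeff ::
  "complex \<Rightarrow> complex \<Rightarrow> complex \<Rightarrow> complex \<Rightarrow> complex \<Rightarrow> nat \<Rightarrow> nat \<Rightarrow> nat \<Rightarrow> complex" where
  "t_coeff \<epsilon> a b c lam l j s = taylor_coeff (\<lambda>t. Tfun \<epsilon> a b c l j (lam + t)) s"

definition e_coeff ::
  "complex \<Rightarrow> complex \<Rightarrow> complex \<Rightarrow> complex \<Rightarrow> complex \<Rightarrow> nat \<Rightarrow> nat \<Rightarrow> complex" where
  "e_coeff \<epsilon> a b c lam j v =
     taylor_coeff (\<lambda>t. E_eps \<epsilon> (of_nat j + lam + t) a b c) v"

end

theory Submission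
  imports Defs
begin

text \<open>
  Write \<open>h\<^sub>n\<close> for the coefficients of the Gauss series. The sum
  \<open>F(M) = \<Sum>n. \<epsilon>\<^sup>n h\<^sub>n / (n + 1 + M)\<close>, a function of the shift \<open>M\<close>, satisfies a first-order
  inhomogeneous recurrence in \<open>M\<close>. It comes from
  \<open>(c + n) (n + 1) h\<^sub>n\<^sub>+\<^sub>1 = (a + n) (b + n) h\<^sub>n\<close>: divide by \<open>n + 1 + M\<close>, sum over \<open>n\<close>, and split both
  quadratic polynomials into a multiple of the denominator and a remainder. The remainders
  contribute \<open>M (M + 1 - c) F(M - 1)\<close> and \<open>\<epsilon> (M + 1 - a) (M + 1 - b) F(M)\<close>; the multiples of the
  denominator contribute a series free of \<open>F\<close> whose value is \<open>E\<^sub>\<epsilon>(M)\<close>. Starting from the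
  shift \<open>\<lambda>\<close> and iterating \<open>\<ell>\<close> times, the homogeneous factors multiply to \<open>\<R>\<^sub>\<ell>\<close> and the
  inhomogeneities acquire the factors \<open>\<T>\<^sub>\<ell>\<^sub>,\<^sub>j\<close>. This is the case \<open>K = 1\<close>. For general \<open>K\<close>, replace
  \<open>M\<close> by \<open>M + t\<close> and compare the coefficients of \<open>t\<^sup>K\<^sup>-\<^sup>1\<close>: the coefficient of \<open>t\<^sup>s\<close> in
  \<open>F(M + t)\<close> is \<open>(-1)\<^sup>s\<close> times the same series with denominators \<open>(n + 1 + M)\<^sup>s\<^sup>+\<^sup>1\<close>. Finally
  \<open>d n + m + 1 = d (n + 1 + \<lambda> + \<ell>)\<close> turns the series of the theorem into the one with shift
  \<open>\<lambda> + \<ell>\<close>.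

  The variable \<open>t\<close> is kept formal. The recurrence is first proved for partial sums, with an
  additional weight \<open>z\<^sup>n\<close>, as an identity of formal power series in \<open>t\<close>
  (\<open>pole_sum_contiguous\<close>); it then passes to the limit coefficient by coefficient. In this way
  neither the analyticity of a conditionally convergent series in \<open>t\<close> nor termwise
  differentiation has to be discussed. The limit of the inhomogeneity is where the two signs
  differ.

  For \<open>\<epsilon> = 1\<close> it is Gauss's summation theorem, in the form
  \<open>(c - a - b) (\<Sum>n<N. h\<^sub>n) + (N + c - 1) h\<^sub>N \<longlonglongrightarrow> E\<^sub>+\<close>, which holds for \<open>Re (c - a - b) > -1\<close>,
  a half-plane in which \<open>\<Sum>n. h\<^sub>n\<close> itself may diverge (\<open>gauss_sum_eq_E_plus\<close>).

  For \<open>\<epsilon> = -1\<close> the series for \<open>E\<^sub>-\<close> need not converge at \<open>-1\<close>. The identity is therefore taken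
  at \<open>z = -r\<close> with \<open>r < 1\<close>, where the inhomogeneity is expressed by the hypergeometric function
  and its derivative; as \<open>r \<rightarrow> 1\<close> these are continuous, and the pole series converge by
  Abel's limit theorem (\<open>pole_fps_contiguous_minus_1\<close>). Continuity at \<open>-1\<close> needs the analytic
  continuation of the hypergeometric series to the cut plane: Euler's integral gives it when
  \<open>Re b\<close> and \<open>Re (c - b)\<close> exceed \<open>1\<close>, and differential contiguous relations carry it to all
  other parameters (\<open>hyp_continuation_exists\<close>).
\<close>

section \<open>The contiguous relation for partial sums\<close>

text \<open>
  The expansion of \<open>1 / (x + X)\<close>. Its coefficients are the signed powers of \<open>1 / x\<close> out of which
  the series with higher powers in the denominator are built.
\<close>
definition shifted_recip :: "complex \<Rightarrow> complex fps" where
  "shifted_recip x = Abs_fps (\<lambda>s. (-1) ^ s / x ^ Suc s)"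

lemma shifted_recip_nth: "fps_nth (shifted_recip x) s = (-1) ^ s / x ^ Suc s"
  by (simp add: shifted_recip_def)

lemma shifted_recip_mult:
  assumes "x \<noteq> 0"
  shows "(fps_const x + fps_X) * shifted_recip x = 1"
proof (rule fps_ext)
  fix s
  show "fps_nth ((fps_const x + fps_X) * shifted_recip x) s = fps_nth 1 s"
    using assms by (cases s) (simp_all add: distrib_right shifted_recip_nth field_simps)
qed

lemma hyp_coeff_0 [simp]: "hyp_coeff a b c 0 = 1"
  by (simp add: hyp_coeff_def)

lemma hyp_coeff_Suc:
  assumes "c \<notin> \<int>\<^sub>\<le>\<^sub>0"
  shows "(c + of_nat n) * of_nat (Suc n) * hyp_coeff a b c (Suc n) =
         (a + of_nat n) * (b + of_nat n) * hyp_coeff a b c n"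
proof -
  have "pochhammer c n \<noteq> 0" "c + of_nat n \<noteq> 0"
    using assms pochhammer_eq_0_imp_nonpos_Int[of c n] pochhammer_eq_0_imp_nonpos_Int[of c "Suc n"]
    by (auto simp: pochhammer_Suc)
  moreover have "(1 + of_nat n :: complex) \<noteq> 0"
    using of_nat_neq_0[of n, where 'a=complex] by simp
  ultimately show ?thesis
    by (simp add: hyp_coeff_def pochhammer_Suc divide_simps)
qed

text \<open>
  Division of a quadratic polynomial by the linear polynomial \<open>Y\<close> with remainder; \<open>r\<close> is the
  reciprocal of \<open>Y\<close>.
\<close>
lemma quadratic_division:
  fixes Y r u v :: "'a :: comm_ring_1"
  assumes "Y * r = 1"
  shows "(Y - u) * (Y - v) * r = Y - (u + v) + u * v * r"
proof -
  have "(Y - u) * (Y - v) * r = (Y * r) * (Y - u - v) + u * v * r"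
    by (simp add: algebra_simps)
  with assms show ?thesis by simp
qed

text \<open>
  The partial sums of \<open>\<Sum>n. z\<^sup>n h\<^sub>n / (n + 1 + M + X)\<close>, a formal power series in the increment \<open>X\<close> of
  the shift \<open>M\<close>.
\<close>
definition pole_sum :: "complex \<Rightarrow> complex \<Rightarrow> complex \<Rightarrow> complex \<Rightarrow> complex \<Rightarrow> nat \<Rightarrow> complex fps" where
  "pole_sum z a b c M N =
     (\<Sum>n<N. fps_const (z ^ n * hyp_coeff a b c n) * shifted_recip (of_nat n + 1 + M))"

text \<open>
  What the divisions by \<open>n + M + X\<close> and by \<open>n + 1 + M + X\<close> leave behind as quotients. Each summand
  has degree at most one in \<open>X\<close>, and for \<open>z = 1\<close> the variable \<open>X\<close> cancels.
\<close>
definition poly_rest :: "complex \<Rightarrow> complex \<Rightarrow> complex \<Rightarrow> complex \<Rightarrow> complex \<Rightarrow> nat \<Rightarrow> complex fps" where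
  "poly_rest z a b c M N =
     (\<Sum>n<N. fps_const (z ^ n * hyp_coeff a b c n) *
        ((fps_const (of_nat n + c - 1 - M) - fps_X) -
         fps_const z * (fps_const (of_nat n + a + b - 1 - M) - fps_X)))"

text \<open>
  The coefficient recurrence makes the sum telescope: the terms
  \<open>z\<^sup>n h\<^sub>n (c + n - 1) n / (n + M + X)\<close> that arise from the shift \<open>M - 1\<close> are, moved by one index,
  those that arise from the shift \<open>M\<close>. Only the last of them survives, as boundary term.
\<close>
theorem pole_sum_contiguous:
  assumes c: "c \<notin> \<int>\<^sub>\<le>\<^sub>0" and M: "\<And>n. of_nat n + M \<noteq> 0"
  shows "fps_const z * (fps_const (M + 1 - a) + fps_X) * (fps_const (M + 1 - b) + fps_X) *
           pole_sum z a b c M N =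
         (fps_const M + fps_X) * (fps_const (M + 1 - c) + fps_X) * pole_sum z a b c (M - 1) N +
         poly_rest z a b c M N +
         fps_const (z ^ N * hyp_coeff a b c N * (c + of_nat N - 1) * of_nat N) *
           shifted_recip (of_nat N + M)"
proof (induction N)
  case 0
  show ?case by (simp add: pole_sum_def poly_rest_def)
next
  case (Suc N)
  define w where "w = fps_const (z ^ N * hyp_coeff a b c N)"
  define r where "r = shifted_recip (of_nat N + M)"
  define r' where "r' = shifted_recip (of_nat N + 1 + M)"
  define C where "C = (fps_const :: complex \<Rightarrow> _)"
  note C = C_def[symmetric]
  have CC: "C (x + y) = C x + C y" "C (x - y) = C x - C y" "C (x * y) = C x * C y" "C 1 = 1"
    for x y by (simp_all add: C_def)
  have r: "(C (of_nat N + M) + fps_X) * r = 1"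
    unfolding r_def C_def by (rule shifted_recip_mult) (rule M)
  have r': "(C (of_nat N + 1 + M) + fps_X) * r' = 1"
    unfolding r'_def C_def
    by (rule shifted_recip_mult) (use M[of "Suc N"] in \<open>simp add: add_ac\<close>)
  have A: "(C (M + 1 - a) + fps_X) * (C (M + 1 - b) + fps_X) * r' =
      C (a + of_nat N) * C (b + of_nat N) * r' - (C (of_nat N + a + b - 1 - M) - fps_X)"
    using quadratic_division[OF r', of "C (a + of_nat N)" "C (b + of_nat N)"]
    by (simp add: CC algebra_simps)
  have B: "(C M + fps_X) * (C (M + 1 - c) + fps_X) * r =
      C ((c + of_nat N - 1) * of_nat N) * r - (C (of_nat N + c - 1 - M) - fps_X)"
    using quadratic_division[OF r, of "C (of_nat N)" "C (of_nat N + c - 1)"]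
    by (simp add: CC algebra_simps)
  have h: "C z * w * C (a + of_nat N) * C (b + of_nat N) =
        C (z ^ Suc N * hyp_coeff a b c (Suc N) * (c + of_nat N) * of_nat (Suc N))"
  proof -
    have "z * (z ^ N * hyp_coeff a b c N) * (a + of_nat N) * (b + of_nat N) =
          z ^ Suc N * ((a + of_nat N) * (b + of_nat N) * hyp_coeff a b c N)"
      by (simp add: mult_ac)
    also have "\<dots> = z ^ Suc N * hyp_coeff a b c (Suc N) * (c + of_nat N) * of_nat (Suc N)"
      by (subst hyp_coeff_Suc[OF c, symmetric]) (simp only: mult_ac)
    finally show ?thesis unfolding w_def C by (simp only: CC(3)[symmetric])
  qed
  have P: "pole_sum z a b c M (Suc N) = pole_sum z a b c M N + w * r'"
    by (simp add: pole_sum_def w_def r'_def)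
  have P1: "pole_sum z a b c (M - 1) (Suc N) = pole_sum z a b c (M - 1) N + w * r"
    by (simp add: pole_sum_def w_def r_def)
  have Q: "poly_rest z a b c M (Suc N) = poly_rest z a b c M N +
       w * ((C (of_nat N + c - 1 - M) - fps_X) - C z * (C (of_nat N + a + b - 1 - M) - fps_X))"
    by (simp add: poly_rest_def w_def C_def)
  have "C z * (C (M + 1 - a) + fps_X) * (C (M + 1 - b) + fps_X) * pole_sum z a b c M (Suc N) =
        C z * (C (M + 1 - a) + fps_X) * (C (M + 1 - b) + fps_X) * pole_sum z a b c M N +
        C z * w * ((C (M + 1 - a) + fps_X) * (C (M + 1 - b) + fps_X) * r')"
    unfolding P by (simp only: algebra_simps)
  also have "\<dots> = (C M + fps_X) * (C (M + 1 - c) + fps_X) * pole_sum z a b c (M - 1) N +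
       poly_rest z a b c M N + w * (C ((c + of_nat N - 1) * of_nat N) * r) +
       (C z * w * C (a + of_nat N) * C (b + of_nat N)) * r'
       - C z * w * (C (of_nat N + a + b - 1 - M) - fps_X)"
    unfolding A using Suc.IH unfolding C r_def[symmetric]
    by (simp add: algebra_simps w_def C CC)
  also have "w * (C ((c + of_nat N - 1) * of_nat N) * r) =
       w * ((C M + fps_X) * (C (M + 1 - c) + fps_X) * r) + w * (C (of_nat N + c - 1 - M) - fps_X)"
    unfolding B by (simp add: algebra_simps)
  finally show ?case
    unfolding C P1 Q h unfolding C_def r'_def
    by (simp add: algebra_simps)
qed

section \<open>Growth of the coefficients\<close>

lemma pochhammer_nonzero:
  fixes c :: complex
  assumes "c \<notin> \<int>\<^sub>\<le>\<^sub>0"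
  shows "pochhammer c n \<noteq> 0"
  using assms pochhammer_eq_0_imp_nonpos_Int by blast

lemma plus_of_nat_nonzero:
  fixes c :: complex
  assumes "c \<notin> \<int>\<^sub>\<le>\<^sub>0"
  shows "c + of_nat n \<noteq> 0"
  using pochhammer_nonzero[OF assms, of "Suc n"] by (auto simp: pochhammer_Suc)

lemma plus_of_nat_notin_nonpos_Ints:
  fixes c :: complex
  assumes "c \<notin> \<int>\<^sub>\<le>\<^sub>0"
  shows "c + of_nat n \<notin> \<int>\<^sub>\<le>\<^sub>0"
proof
  assume "c + of_nat n \<in> \<int>\<^sub>\<le>\<^sub>0"
  then obtain k where "c + of_nat n = - of_nat k" by (elim nonpos_Ints_cases')
  hence "c + of_nat (n + k) = 0" by (simp flip: add.assoc)
  with plus_of_nat_nonzero[OF assms] show False by blast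
qed

text \<open>
  The three Pochhammer symbols are the numerators of the sequences that converge to \<open>1 / \<Gamma>\<close>, so the
  coefficients grow like \<open>n\<^sup>a\<^sup>+\<^sup>b\<^sup>-\<^sup>c\<^sup>-\<^sup>1\<close>.
\<close>
lemma hyp_coeff_asymptotics:
  assumes c: "c \<notin> \<int>\<^sub>\<le>\<^sub>0"
  shows "(\<lambda>n. hyp_coeff a b c (Suc n) * of_nat (Suc n) * exp (- (a + b - c) * of_real (ln (real n))))
           \<longlonglongrightarrow> rGamma a * rGamma b / rGamma c"
proof -
  have "(\<lambda>n. rGamma_series a n * rGamma_series b n / rGamma_series c n)
          \<longlonglongrightarrow> rGamma a * rGamma b / rGamma c"
    using c by (intro tendsto_intros) (simp add: rGamma_eq_zero_iff)
  also have "(\<lambda>n. rGamma_series a n * rGamma_series b n / rGamma_series c n) =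
     (\<lambda>n. hyp_coeff a b c (Suc n) * of_nat (Suc n) * exp (- (a + b - c) * of_real (ln (real n))))"
  proof
    fix n
    define L where "L = complex_of_real (ln (real n))"
    have n0: "(of_nat (Suc n) :: complex) \<noteq> 0" by (rule of_nat_neq_0)
    have e: "exp (- (a + b - c) * L) = exp (c * L) / (exp (a * L) * exp (b * L))"
      unfolding exp_add[symmetric] exp_diff[symmetric] by (simp add: algebra_simps)
    have H: "hyp_coeff a b c (Suc n) * of_nat (Suc n) =
        pochhammer a (Suc n) * pochhammer b (Suc n) / (pochhammer c (Suc n) * fact n)"
      unfolding hyp_coeff_def fact_Suc using n0 by (simp del: of_nat_Suc pochhammer_Suc)
    thus "rGamma_series a n * rGamma_series b n / rGamma_series c n =
      hyp_coeff a b c (Suc n) * of_nat (Suc n) * exp (- (a + b - c) * of_real (ln (real n)))"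
      unfolding L_def[symmetric] e H by (simp add: rGamma_series_def L_def mult_ac)
  qed
  finally show ?thesis .
qed

lemma hyp_coeff_bound:
  assumes c: "c \<notin> \<int>\<^sub>\<le>\<^sub>0"
  obtains C where "C > 0" "\<And>n. n \<ge> 1 \<Longrightarrow>
    norm (hyp_coeff a b c (Suc n)) \<le> C * real n powr (Re (a + b - c) - 1)"
proof -
  from convergent_imp_Bseq[OF convergentI[OF hyp_coeff_asymptotics[OF c, of a b]]]
  obtain C where C: "C > 0" "\<And>n. norm (hyp_coeff a b c (Suc n) * of_nat (Suc n) *
      exp (- (a + b - c) * of_real (ln (real n)))) \<le> C"
    unfolding Bseq_def by blast
  have "norm (hyp_coeff a b c (Suc n)) \<le> C * real n powr (Re (a + b - c) - 1)" if n: "n \<ge> 1" for n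
  proof -
    define p where "p = real n powr Re (a + b - c)"
    have p: "p > 0" "real n > 0" using n by (auto simp: p_def)
    have e: "norm (exp (- (a + b - c) * of_real (ln (real n)))) = inverse p"
      using p(2) unfolding norm_exp_eq_Re p_def powr_def
      by (simp add: exp_minus[symmetric] algebra_simps)
    have s: "norm (of_nat (Suc n) :: complex) = real (Suc n)" by (rule norm_of_nat)
    have "norm (hyp_coeff a b c (Suc n)) * real (Suc n) * inverse p \<le> C"
      using C(2)[of n] unfolding norm_mult e s .
    moreover have "norm (hyp_coeff a b c (Suc n)) * real n * inverse p \<le>
          norm (hyp_coeff a b c (Suc n)) * real (Suc n) * inverse p"
      using p by (intro mult_mono) auto
    ultimately have "norm (hyp_coeff a b c (Suc n)) * real n * inverse p \<le> C" by linarith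
    hence "norm (hyp_coeff a b c (Suc n)) \<le> C * (p / real n)"
      using p by (simp add: field_simps)
    also have "p / real n = real n powr (Re (a + b - c) - 1)"
      using p unfolding p_def by (simp add: powr_diff)
    finally show ?thesis .
  qed
  thus ?thesis by (rule that[OF C(1)])
qed

lemma hyp_coeff_tendsto_0:
  assumes c: "c \<notin> \<int>\<^sub>\<le>\<^sub>0" and "Re (c - a - b) > -1"
  shows "hyp_coeff a b c \<longlonglongrightarrow> 0"
proof -
  obtain C where C: "C > 0" "\<And>n. n \<ge> 1 \<Longrightarrow>
      norm (hyp_coeff a b c (Suc n)) \<le> C * real n powr (Re (a + b - c) - 1)"
    using hyp_coeff_bound[OF c, of a b] by metis
  have "Re (a + b - c) - 1 < 0" using assms by simp
  hence "(\<lambda>n. C * real n powr (Re (a + b - c) - 1)) \<longlonglongrightarrow> 0"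
    by (intro tendsto_mult_right_zero tendsto_neg_powr filterlim_real_sequentially)
  hence "(\<lambda>n. hyp_coeff a b c (Suc n)) \<longlonglongrightarrow> 0"
    by (rule Lim_null_comparison[rotated]) (use C(2) in \<open>auto simp: eventually_at_top_linorder\<close>)
  thus ?thesis by (simp add: filterlim_sequentially_Suc)
qed

lemma hyp_coeff_over_n_summable:
  assumes c: "c \<notin> \<int>\<^sub>\<le>\<^sub>0" and "Re (c - a - b) > -1"
  shows "summable (\<lambda>n. norm (hyp_coeff a b c n) / real (Suc n))"
    and "summable (\<lambda>n. norm (hyp_coeff a b c (Suc n)) / real (Suc n))"
proof -
  obtain C where C: "C > 0" "\<And>n. n \<ge> 1 \<Longrightarrow>
      norm (hyp_coeff a b c (Suc n)) \<le> C * real n powr (Re (a + b - c) - 1)"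
    using hyp_coeff_bound[OF c, of a b] by metis
  have le: "norm (hyp_coeff a b c (Suc n)) / real (Suc n) \<le> C * real n powr (Re (a + b - c) - 2)"
    if "n \<ge> 1" for n
  proof -
    have "norm (hyp_coeff a b c (Suc n)) / real (Suc n) \<le> norm (hyp_coeff a b c (Suc n)) / real n"
      using that by (intro divide_left_mono) auto
    also have "\<dots> \<le> C * real n powr (Re (a + b - c) - 1) / real n"
      using C(2)[OF that] that by (intro divide_right_mono) auto
    also have "\<dots> = C * real n powr (Re (a + b - c) - 2)"
      using that powr_add[of "real n" "Re (a + b - c) - 2" 1] by (simp add: field_simps)
    finally show ?thesis .
  qed
  have "summable (\<lambda>n. C * real n powr (Re (a + b - c) - 2))"
    using assms by (intro summable_mult) (simp add: summable_real_powr_iff)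
  thus s: "summable (\<lambda>n. norm (hyp_coeff a b c (Suc n)) / real (Suc n))"
    by (rule summable_comparison_test'[where N = 1]) (use le in auto)
  have "summable (\<lambda>n. norm (hyp_coeff a b c (Suc n)) / real (Suc (Suc n)))"
    by (rule summable_comparison_test'[OF s, where N = 0])
       (auto intro!: divide_left_mono)
  thus "summable (\<lambda>n. norm (hyp_coeff a b c n) / real (Suc n))"
    by (subst (asm) summable_Suc_iff)
qed

section \<open>Gauss's summation theorem in the half-plane \<open>Re (c - a - b) > -1\<close>\<close>

text \<open>
  For \<open>c \<noteq> 1\<close> this is \<open>c - 1\<close> times the hypergeometric series with parameters
  \<open>a - 1, b - 1, c - 1\<close> at \<open>1\<close>; the chosen form also makes sense for \<open>c = 1\<close>.
\<close>
definition gauss_sum :: "complex \<Rightarrow> complex \<Rightarrow> complex \<Rightarrow> complex" where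
  "gauss_sum a b c = (c - 1) + (a - 1) * (b - 1) * (\<Sum>n. hyp_coeff a b c n / of_nat (Suc n))"

lemma gauss_partial_sum:
  assumes c: "c \<notin> \<int>\<^sub>\<le>\<^sub>0"
  shows "(c - a - b) * (\<Sum>n<N. hyp_coeff a b c n) + (of_nat N + c - 1) * hyp_coeff a b c N =
         (c - 1) + (a - 1) * (b - 1) * (\<Sum>n<N. hyp_coeff a b c n / of_nat (Suc n))"
proof (induction N)
  case (Suc N)
  define h where "h = hyp_coeff a b c N"
  have nz: "(of_nat (Suc N) :: complex) \<noteq> 0" by (rule of_nat_neq_0)
  have e: "(c + of_nat N) * hyp_coeff a b c (Suc N) = (a + of_nat N) * (b + of_nat N) * h / of_nat (Suc N)"
    using hyp_coeff_Suc[OF c, of N a b] nz unfolding h_def by (simp add: field_simps)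
  have "(c - a - b) * h + (c + of_nat N) * hyp_coeff a b c (Suc N) - (of_nat N + c - 1) * h =
        (a - 1) * (b - 1) * (h / of_nat (Suc N))"
    unfolding e using nz by (simp add: divide_simps) (simp add: algebra_simps)
  hence "(c - a - b) * h + (of_nat (Suc N) + c - 1) * hyp_coeff a b c (Suc N) =
        (of_nat N + c - 1) * h + (a - 1) * (b - 1) * (h / of_nat (Suc N))"
    by (simp add: algebra_simps)
  thus ?case using Suc.IH
    unfolding sum.lessThan_Suc h_def[symmetric] distrib_left by (simp only: ac_simps) algebra
qed simp

lemma gauss_sum_LIMSEQ:
  assumes c: "c \<notin> \<int>\<^sub>\<le>\<^sub>0" and r: "Re (c - a - b) > -1"
  shows "(\<lambda>N. (c - a - b) * (\<Sum>n<N. hyp_coeff a b c n) + (of_nat N + c - 1) * hyp_coeff a b c N)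
           \<longlonglongrightarrow> gauss_sum a b c"
proof -
  have "summable (\<lambda>n. norm (hyp_coeff a b c n / of_nat (Suc n)))"
    using hyp_coeff_over_n_summable(1)[OF c r] unfolding norm_divide norm_of_nat .
  hence "summable (\<lambda>n. hyp_coeff a b c n / of_nat (Suc n))"
    by (rule summable_norm_cancel)
  thus ?thesis unfolding gauss_partial_sum[OF c] gauss_sum_def
    by (intro tendsto_intros summable_LIMSEQ)
qed

text \<open>
  A first relation between the parameters \<open>c\<close> and \<open>c + 1\<close>. Its partial sums on the right belong to
  a series that converges in the whole half-plane \<open>Re (c - a - b) > -1\<close>.
\<close>
lemma gauss_partial_sum_shift:
  assumes c: "c \<notin> \<int>\<^sub>\<le>\<^sub>0"
  shows "c * ((c - a - b) * (\<Sum>n<N. hyp_coeff a b c n) + (of_nat N + c - 1) * hyp_coeff a b c N) =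
         (c - a) * (c - b) * (\<Sum>n<N. hyp_coeff a b (c + 1) n) + (c - 1) * c * hyp_coeff a b c N"
proof (induction N)
  case (Suc N)
  define h where "h = hyp_coeff a b c N"
  define S where "S = (of_nat (Suc N) :: complex)"
  have nz: "S \<noteq> 0" unfolding S_def by (rule of_nat_neq_0)
  have cn: "c + of_nat N \<noteq> 0" and c0: "c \<noteq> 0"
    using plus_of_nat_nonzero[OF c, of N] plus_of_nat_nonzero[OF c, of 0] by auto
  have e: "hyp_coeff a b c (Suc N) = (a + of_nat N) * (b + of_nat N) * h / ((c + of_nat N) * S)"
    using hyp_coeff_Suc[OF c, of N a b] nz cn unfolding h_def S_def
    by (subst nonzero_eq_divide_eq) (simp_all only: mult_eq_0_iff mult_ac simp_thms)
  have "pochhammer (c + 1) N \<noteq> 0" "pochhammer c N \<noteq> 0"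
    using pochhammer_nonzero[OF c, of "Suc N"] pochhammer_nonzero[OF c, of N]
    by (auto simp: pochhammer_rec)
  moreover have "c * pochhammer (c + 1) N = pochhammer c N * (c + of_nat N)"
    by (metis pochhammer_rec pochhammer_Suc)
  ultimately have g: "hyp_coeff a b (c + 1) N = h * c / (c + of_nat N)"
    using c0 cn unfolding h_def hyp_coeff_def by (simp add: divide_simps)
  have N: "of_nat N = S - 1" by (simp add: S_def)
  have "c * ((c - a - b) * h + (of_nat N + c) * hyp_coeff a b c (Suc N)
             - (of_nat N + c - 1) * h) =
        (c - a) * (c - b) * hyp_coeff a b (c + 1) N + (c - 1) * c * (hyp_coeff a b c (Suc N) - h)"
    using cn nz unfolding e g unfolding N by (simp add: divide_simps) (simp add: algebra_simps)
  moreover have "of_nat (Suc N) = (of_nat N + 1 :: complex)" by simp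
  ultimately show ?case
    using Suc.IH unfolding sum.lessThan_Suc h_def by algebra
qed simp

text \<open>
  Both sides are limits of the same sequence: the partial sums for \<open>c + 1\<close> occur in
  \<open>gauss_partial_sum_shift\<close> for \<open>c\<close> and in \<open>gauss_sum_LIMSEQ\<close> for \<open>c + 1\<close>.
\<close>
lemma gauss_sum_shift:
  assumes c: "c \<notin> \<int>\<^sub>\<le>\<^sub>0" and r: "Re (c - a - b) > -1"
  shows "c * (c + 1 - a - b) * gauss_sum a b c = (c - a) * (c - b) * gauss_sum a b (c + 1)"
proof -
  have c1: "c + 1 \<notin> \<int>\<^sub>\<le>\<^sub>0" using plus_of_nat_notin_nonpos_Ints[OF c, of 1] by simp
  have r1: "Re (c + 1 - a - b) > -1" using r by simp
  let ?g = "hyp_coeff a b (c + 1)"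
  have "(\<lambda>N. (c - a) * (c - b) * ((c + 1 - a - b) * (\<Sum>n<N. ?g n) + (of_nat N + (c + 1) - 1) * ?g N))
      \<longlonglongrightarrow> (c - a) * (c - b) * gauss_sum a b (c + 1)"
    by (intro tendsto_intros gauss_sum_LIMSEQ[OF c1 r1])
  moreover have "(\<lambda>N. (c + 1 - a - b) * (c * ((c - a - b) * (\<Sum>n<N. hyp_coeff a b c n) +
         (of_nat N + c - 1) * hyp_coeff a b c N) - (c - 1) * c * hyp_coeff a b c N)
         + (c - a) * (c - b) * (c * hyp_coeff a b c N))
      \<longlonglongrightarrow> (c + 1 - a - b) * (c * gauss_sum a b c - (c - 1) * c * 0) + (c - a) * (c - b) * (c * 0)"
    by (intro tendsto_intros gauss_sum_LIMSEQ[OF c r] hyp_coeff_tendsto_0[OF c r])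
  moreover have "(c - a) * (c - b) * ((c + 1 - a - b) * (\<Sum>n<N. ?g n) + (of_nat N + (c + 1) - 1) * ?g N) =
     (c + 1 - a - b) * (c * ((c - a - b) * (\<Sum>n<N. hyp_coeff a b c n) +
         (of_nat N + c - 1) * hyp_coeff a b c N) - (c - 1) * c * hyp_coeff a b c N)
         + (c - a) * (c - b) * (c * hyp_coeff a b c N)" for N
  proof -
    have "c + of_nat N \<noteq> 0" "pochhammer (c + 1) N \<noteq> 0" "pochhammer c N \<noteq> 0"
      using plus_of_nat_nonzero[OF c, of N] pochhammer_nonzero[OF c, of N]
        pochhammer_nonzero[OF c1, of N] by auto
    moreover have "c * pochhammer (c + 1) N = pochhammer c N * (c + of_nat N)"
      by (metis pochhammer_rec pochhammer_Suc)
    ultimately have "(of_nat N + c) * ?g N = c * hyp_coeff a b c N"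
      unfolding hyp_coeff_def by (simp add: divide_simps)
    thus ?thesis unfolding gauss_partial_sum_shift[OF c] by (simp add: algebra_simps)
  qed
  ultimately show ?thesis using LIMSEQ_unique by (fastforce simp: mult_ac)
qed

lemma gauss_sum_shift_n:
  assumes c: "c \<notin> \<int>\<^sub>\<le>\<^sub>0" and r: "Re (c - a - b) > -1"
  shows "pochhammer c N * pochhammer (c - a - b + 1) N * gauss_sum a b c =
         pochhammer (c - a) N * pochhammer (c - b) N * gauss_sum a b (c + of_nat N)"
proof (induction N)
  case (Suc N)
  have "(c + of_nat N) * (c + of_nat N + 1 - a - b) * gauss_sum a b (c + of_nat N) =
        (c + of_nat N - a) * (c + of_nat N - b) * gauss_sum a b (c + of_nat N + 1)"
    using r by (intro gauss_sum_shift plus_of_nat_notin_nonpos_Ints[OF c]) auto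
  moreover have "c + of_nat (Suc N) = c + of_nat N + 1" by simp
  ultimately show ?case
    using Suc.IH unfolding pochhammer_Suc by algebra
qed simp

lemma Re_pos_notin_nonpos_Ints:
  assumes "Re c > 0"
  shows "c \<notin> \<int>\<^sub>\<le>\<^sub>0"
proof
  assume "c \<in> \<int>\<^sub>\<le>\<^sub>0"
  then obtain k where "c = - of_nat k" by (elim nonpos_Ints_cases')
  with assms show False by simp
qed

text \<open>
  Every factor \<open>c + k\<close> of the denominator moves away from the origin when \<open>c\<close> moves to the right.
\<close>
lemma hyp_coeff_antimono_c:
  assumes "Re c > 0"
  shows "norm (hyp_coeff a b (c + of_nat N) n) \<le> norm (hyp_coeff a b c n)"
proof -
  have c: "c \<notin> \<int>\<^sub>\<le>\<^sub>0" using assms by (rule Re_pos_notin_nonpos_Ints)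
  have "norm (pochhammer c n) \<le> norm (pochhammer (c + of_nat N) n)"
    unfolding pochhammer_prod prod_norm[symmetric]
  proof (intro prod_mono conjI norm_ge_zero)
    fix k
    have "(Re c + real k)\<^sup>2 + (Im c)\<^sup>2 \<le> (Re c + real N + real k)\<^sup>2 + (Im c)\<^sup>2"
      using assms by (intro add_right_mono power_mono) auto
    thus "cmod (c + of_nat k) \<le> cmod (c + of_nat N + of_nat k)"
      unfolding cmod_def by (intro real_sqrt_le_mono) simp
  qed
  moreover have "norm (pochhammer c n) > 0" using pochhammer_nonzero[OF c] by simp
  ultimately show ?thesis
    unfolding hyp_coeff_def norm_divide norm_mult
    by (intro divide_left_mono mult_right_mono mult_pos_pos) auto
qed

text \<open>
  The series in the definition stays bounded as \<open>c\<close> moves to the right, so the summand \<open>c - 1\<close>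
  dominates.
\<close>
lemma gauss_sum_growth:
  assumes c: "c \<notin> \<int>\<^sub>\<le>\<^sub>0" and r: "Re (c - a - b) > -1"
  shows "(\<lambda>N. gauss_sum a b (c + of_nat N) / of_nat N) \<longlonglongrightarrow> 1"
proof -
  \<comment> \<open>Coefficients are comparable only once the parameter lies in the right half-plane.\<close>
  obtain N0 :: nat where N0: "real N0 > - Re c" using reals_Archimedean2 by blast
  define c0 where "c0 = c + of_nat N0"
  have c0: "c0 \<notin> \<int>\<^sub>\<le>\<^sub>0" unfolding c0_def by (rule plus_of_nat_notin_nonpos_Ints[OF c])
  have r0: "Re (c0 - a - b) > -1" "Re c0 > 0" using r N0 c0 by (auto simp: c0_def)
  define B where "B = (\<Sum>n. norm (hyp_coeff a b c0 n) / real (Suc n))"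
  have bd: "norm (\<Sum>n. hyp_coeff a b (c0 + of_nat N) n / of_nat (Suc n)) \<le> B" for N
    unfolding B_def
  proof (rule norm_suminf_le)
    show "norm (hyp_coeff a b (c0 + of_nat N) n / of_nat (Suc n)) \<le>
          norm (hyp_coeff a b c0 n) / real (Suc n)" for n
      unfolding norm_divide norm_of_nat
      by (intro divide_right_mono hyp_coeff_antimono_c r0) auto
  qed (use hyp_coeff_over_n_summable[OF c0 r0(1)] in simp)
  define S where "S = (\<lambda>N. \<Sum>n. hyp_coeff a b (c0 + of_nat N) n / of_nat (Suc n))"
  have SB: "norm (S N) \<le> B" for N unfolding S_def by (rule bd)
  have "(\<lambda>N. S N / of_nat (N + N0)) \<longlonglongrightarrow> 0"
  proof (rule Lim_null_comparison)
    show "\<forall>\<^sub>F N in sequentially. norm (S N / of_nat (N + N0)) \<le> B / real (N + N0)"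
      unfolding norm_divide norm_of_nat by (intro always_eventually allI divide_right_mono SB) auto
    show "(\<lambda>N. B / real (N + N0)) \<longlonglongrightarrow> 0" by real_asymp
  qed
  hence S0: "(\<lambda>N. (a - 1) * (b - 1) * (S N / of_nat (N + N0))) \<longlonglongrightarrow> 0"
    by (rule tendsto_mult_right_zero)
  have "(\<lambda>N. (c - 1) / of_nat (N + N0)) \<longlonglongrightarrow> 0"
    by (intro tendsto_divide_0[OF tendsto_const] filterlim_compose[OF tendsto_of_nat]
              filterlim_add_const_nat_at_top)
  hence "(\<lambda>N. (c - 1) / of_nat (N + N0) + 1 + (a - 1) * (b - 1) * (S N / of_nat (N + N0)))
          \<longlonglongrightarrow> 0 + 1 + 0"
    by (intro tendsto_intros S0)
  moreover have "\<forall>\<^sub>F N in sequentially. (c - 1) / of_nat (N + N0) + 1 +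
        (a - 1) * (b - 1) * (S N / of_nat (N + N0)) =
        gauss_sum a b (c + of_nat (N + N0)) / of_nat (N + N0)"
    using eventually_gt_at_top[of 0]
  proof eventually_elim
    case (elim N)
    hence "(of_nat (N + N0) :: complex) \<noteq> 0" by (subst of_nat_eq_0_iff) simp
    moreover have cN: "c + of_nat (N + N0) = c0 + of_nat N" by (simp add: c0_def)
    have "gauss_sum a b (c + of_nat (N + N0)) =
        c - 1 + of_nat (N + N0) + (a - 1) * (b - 1) * S N"
      unfolding cN gauss_sum_def S_def using cN by (simp add: algebra_simps)
    ultimately show ?case by (simp add: add_divide_distrib)
  qed
  ultimately have "(\<lambda>N. gauss_sum a b (c + of_nat (N + N0)) / of_nat (N + N0)) \<longlonglongrightarrow> 1"
    by (simp add: Lim_transform_eventually)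
  thus ?thesis by (rule LIMSEQ_offset)
qed

text \<open>
  Gauss's argument: by \<open>gauss_sum_shift_n\<close>, moving \<open>c\<close> to \<open>c + n + 1\<close> multiplies the sum by a
  quotient of Pochhammer symbols. Normalised by powers of \<open>n\<close>, these tend to reciprocal Gamma
  values, and the growth \<open>c + n\<close> of the shifted sum accounts for the one power of \<open>n\<close> that remains.
\<close>
theorem gauss_sum_eq_E_plus:
  assumes c: "c \<notin> \<int>\<^sub>\<le>\<^sub>0" and r: "Re (c - a - b) > -1"
  shows "gauss_sum a b c = E_plus M a b c"
proof -
  let ?G = "\<lambda>n. gauss_sum a b (c + of_nat (Suc n)) / of_nat (Suc n)"
  have eq: "rGamma_series c n * rGamma_series (c - a - b + 1) n * gauss_sum a b c =
       rGamma_series (c - a) n * rGamma_series (c - b) n * (?G n * (of_nat (Suc n) / of_nat n))"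
    if n: "n > 0" for n
  proof -
    define L where "L = complex_of_real (ln (real n))"
    have L: "exp L = of_nat n" using n by (simp add: L_def exp_of_real)
    have e: "exp (c * L) * exp ((c - a - b + 1) * L) =
             exp ((c - a) * L) * exp ((c - b) * L) * of_nat n"
      unfolding L[symmetric] exp_add[symmetric] by (simp add: algebra_simps)
    have n0: "(of_nat n :: complex) \<noteq> 0" "(of_nat (Suc n) :: complex) \<noteq> 0"
      using n by (simp_all del: of_nat_Suc)
    have "?G n * (of_nat (Suc n) / of_nat n) = gauss_sum a b (c + of_nat (Suc n)) / of_nat n"
      using n0 by (simp del: of_nat_Suc)
    moreover have "rGamma_series c n * rGamma_series (c - a - b + 1) n * gauss_sum a b c =
       (pochhammer c (Suc n) * pochhammer (c - a - b + 1) (Suc n) * gauss_sum a b c) /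
       (fact n * fact n * (exp (c * L) * exp ((c - a - b + 1) * L)))"
      by (simp add: rGamma_series_def L_def)
    moreover have "rGamma_series (c - a) n * rGamma_series (c - b) n *
         (gauss_sum a b (c + of_nat (Suc n)) / of_nat n) =
       (pochhammer (c - a) (Suc n) * pochhammer (c - b) (Suc n) * gauss_sum a b (c + of_nat (Suc n))) /
       (fact n * fact n * (exp ((c - a) * L) * exp ((c - b) * L) * of_nat n))"
      by (simp add: rGamma_series_def L_def)
    ultimately show ?thesis using gauss_sum_shift_n[OF c r, of "Suc n"] e
      by (simp del: of_nat_Suc)
  qed
  have 1: "(\<lambda>n. rGamma_series c n * rGamma_series (c - a - b + 1) n * gauss_sum a b c) \<longlonglongrightarrow>
          rGamma c * rGamma (c - a - b + 1) * gauss_sum a b c"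
    by (intro tendsto_intros)
  have "(\<lambda>n. of_nat (Suc n) / of_nat n :: complex) \<longlonglongrightarrow> 1"
    by (rule LIMSEQ_Suc_n_over_n)
  hence 2: "(\<lambda>n. rGamma_series (c - a) n * rGamma_series (c - b) n * (?G n * (of_nat (Suc n) / of_nat n)))
      \<longlonglongrightarrow> rGamma (c - a) * rGamma (c - b) * (1 * 1)"
    by (intro tendsto_intros LIMSEQ_Suc[OF gauss_sum_growth[OF c r]])
  have "rGamma c * rGamma (c - a - b + 1) * gauss_sum a b c = rGamma (c - a) * rGamma (c - b) * (1 * 1)"
    by (rule LIMSEQ_unique[OF 1 Lim_transform_eventually[OF 2]])
       (rule eventually_mono[OF eventually_gt_at_top[of 0]], rule eq[symmetric])
  moreover have "Re (c - a - b + 1) > 0" using r by simp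
  hence "c - a - b + 1 \<notin> \<int>\<^sub>\<le>\<^sub>0" by (rule Re_pos_notin_nonpos_Ints)
  hence "rGamma (c - a - b + 1) \<noteq> 0" "rGamma c \<noteq> 0"
    using c by (simp_all add: rGamma_eq_zero_iff)
  ultimately show ?thesis
    unfolding E_plus_def Gamma_def by (simp add: divide_simps)  (simp add: mult_ac)
qed

section \<open>Analytic continuation of the hypergeometric series\<close>

abbreviation cut_plane :: "complex set" where
  "cut_plane \<equiv> - (complex_of_real ` {1..})"

text \<open>
  The property by which the hypergeometric function is chosen. Its values are determined only once some
  function is known to have the property.
\<close>
definition hyp_continuation :: "complex \<Rightarrow> complex \<Rightarrow> complex \<Rightarrow> (complex \<Rightarrow> complex) \<Rightarrow> bool" where
  "hyp_continuation a b c f \<longleftrightarrow> f holomorphic_on cut_plane \<and>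
     (\<forall>z\<in>ball 0 1. (\<lambda>n. hyp_coeff a b c n * z ^ n) sums f z)"

lemma open_cut_plane [simp]: "open cut_plane"
proof -
  have "complex_of_real ` {1..} = {z. Im z = 0 \<and> Re z \<ge> 1}"
    by (auto simp: complex_eq_iff image_iff)
  also have "closed \<dots>"
    by (intro closed_Collect_conj closed_Collect_eq closed_Collect_le continuous_intros)
  finally have "closed (complex_of_real ` {1..})" .
  thus ?thesis by (simp add: closed_def)
qed

lemma powser_deriv_sums:
  fixes f :: "complex \<Rightarrow> complex"
  assumes sums: "\<And>z. z \<in> ball 0 1 \<Longrightarrow> (\<lambda>n. h n * z ^ n) sums f z" and z: "z \<in> ball 0 1"
  shows "(\<lambda>n. of_nat n * h n * z ^ n) sums (z * deriv f z)"
proof -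
  have sm: "summable (\<lambda>n. h n * w ^ n)" if "norm w < 1" for w
    using sums[of w] that by (auto simp: sums_iff)
  have nz: "norm z < 1" using z by simp
  have "((\<lambda>w. \<Sum>n. h n * w ^ n) has_field_derivative (\<Sum>n. diffs h n * z ^ n)) (at z)"
    by (rule termdiffs_strong'[OF sm nz])
  hence "(f has_field_derivative (\<Sum>n. diffs h n * z ^ n)) (at z)"
    by (rule has_field_derivative_transform_within_open[of _ _ _ "ball 0 1"])
       (use nz in \<open>auto intro!: sums_unique[symmetric] sums\<close>)
  hence d: "deriv f z = (\<Sum>n. diffs h n * z ^ n)" by (rule DERIV_imp_deriv)
  have "(\<lambda>n. z * (of_nat n * h n * z ^ (n - Suc 0))) sums (z * (\<Sum>n. diffs h n * z ^ n))"
    by (intro sums_mult diffs_equiv termdiff_converges[OF nz sm])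
  also have "(\<lambda>n. z * (of_nat n * h n * z ^ (n - Suc 0))) = (\<lambda>n. of_nat n * h n * z ^ n)"
  proof
    fix n show "z * (of_nat n * h n * z ^ (n - Suc 0)) = of_nat n * h n * z ^ n"
      by (cases n) (auto simp: mult_ac)
  qed
  finally show ?thesis unfolding d .
qed

text \<open>
  The operator \<open>1 + z d/dz / c\<close> multiplies the \<open>n\<close>-th coefficient by \<open>(c + n) / c\<close>, which replaces
  \<open>c + 1\<close> by \<open>c\<close>.
\<close>
lemma hyp_continuation_lower_c:
  assumes f: "hyp_continuation a b (c + 1) f" and c: "c \<notin> \<int>\<^sub>\<le>\<^sub>0"
  shows "hyp_continuation a b c (\<lambda>z. f z + z * deriv f z / c)"
  unfolding hyp_continuation_def
proof (intro conjI ballI)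
  have hol: "f holomorphic_on cut_plane" using f by (simp add: hyp_continuation_def)
  have c0: "c \<noteq> 0" using c by auto
  show "(\<lambda>z. f z + z * deriv f z / c) holomorphic_on cut_plane"
    using c0 by (intro holomorphic_intros hol holomorphic_deriv) auto
  fix z :: complex assume z: "z \<in> ball 0 1"
  let ?h = "hyp_coeff a b (c + 1)"
  have s: "(\<lambda>n. ?h n * w ^ n) sums f w" if "w \<in> ball 0 1" for w
    using f that by (auto simp: hyp_continuation_def)
  have "(\<lambda>n. ?h n * z ^ n + of_nat n * ?h n * z ^ n / c) sums (f z + z * deriv f z / c)"
    by (intro sums_add sums_divide s z powser_deriv_sums)
  moreover have "?h n * z ^ n + of_nat n * ?h n * z ^ n / c = hyp_coeff a b c n * z ^ n" for n
  proof -
    have "pochhammer (c + 1) n \<noteq> 0" "pochhammer c n \<noteq> 0"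
      using pochhammer_nonzero[OF c, of "Suc n"] pochhammer_nonzero[OF c, of n]
      by (auto simp: pochhammer_rec)
    moreover have "c * pochhammer (c + 1) n = pochhammer c n * (c + of_nat n)"
      by (metis pochhammer_rec pochhammer_Suc)
    ultimately have "(c + of_nat n) * ?h n = c * hyp_coeff a b c n"
      unfolding hyp_coeff_def by (simp add: divide_simps)
    hence "hyp_coeff a b c n = (c + of_nat n) * ?h n / c" using c0 by (simp add: field_simps)
    thus ?thesis using c0 by (simp only:) (simp add: field_simps)
  qed
  ultimately show "(\<lambda>n. hyp_coeff a b c n * z ^ n) sums (f z + z * deriv f z / c)" by simp
qed

text \<open>
  The coefficient form of Gauss's differential relation
  \<open>z (1 - z) F' + (c - b - 1 - a z) F = (c - b - 1) G\<close>, where \<open>F\<close> has second parameter \<open>b + 1\<close> and \<open>G\<close>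
  has second parameter \<open>b\<close>.
\<close>
lemma hyp_coeff_lower_b:
  assumes c: "c \<notin> \<int>\<^sub>\<le>\<^sub>0"
  shows "(of_nat (Suc k) + c - b - 1) * hyp_coeff a (b + 1) c (Suc k) -
           (of_nat k + a) * hyp_coeff a (b + 1) c k =
         (c - b - 1) * hyp_coeff a b c (Suc k)"
proof -
  define Q where "Q = pochhammer a (Suc k) * pochhammer (b + 1) k / (pochhammer c (Suc k) * fact (Suc k))"
  have nz: "c + of_nat k \<noteq> 0" "(of_nat (Suc k) :: complex) \<noteq> 0" "pochhammer c k \<noteq> 0"
    using plus_of_nat_nonzero[OF c] pochhammer_nonzero[OF c] of_nat_neq_0 by blast+
  have 1: "hyp_coeff a (b + 1) c (Suc k) = Q * (b + 1 + of_nat k)"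
    by (simp add: hyp_coeff_def Q_def pochhammer_Suc)
  have 2: "hyp_coeff a b c (Suc k) = Q * b"
    by (simp add: hyp_coeff_def Q_def pochhammer_rec[of b])
  have 3: "(of_nat k + a) * hyp_coeff a (b + 1) c k = Q * (c + of_nat k) * of_nat (Suc k)"
    using nz unfolding hyp_coeff_def Q_def pochhammer_Suc fact_Suc
    by (simp add: divide_simps del: of_nat_Suc)
  have 4: "of_nat (Suc k) = (of_nat k + 1 :: complex)" by simp
  show ?thesis unfolding 1 2 3 unfolding 4 by (simp add: algebra_simps)
qed

lemma hyp_continuation_lower_b:
  assumes f: "hyp_continuation a (b + 1) c f" and c: "c \<notin> \<int>\<^sub>\<le>\<^sub>0" and cb: "c - b - 1 \<noteq> 0"
  shows "hyp_continuation a b c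
           (\<lambda>z. (z * (1 - z) * deriv f z + (c - b - 1 - a * z) * f z) / (c - b - 1))"
  unfolding hyp_continuation_def
proof (intro conjI ballI)
  have hol: "f holomorphic_on cut_plane" using f by (simp add: hyp_continuation_def)
  show "(\<lambda>z. (z * (1 - z) * deriv f z + (c - b - 1 - a * z) * f z) / (c - b - 1)) holomorphic_on cut_plane"
    using cb by (intro holomorphic_intros hol holomorphic_deriv) auto
  fix z :: complex assume z: "z \<in> ball 0 1"
  let ?h = "hyp_coeff a (b + 1) c"
  have s: "(\<lambda>n. ?h n * w ^ n) sums f w" if "w \<in> ball 0 1" for w
    using f that by (auto simp: hyp_continuation_def)
  note d = powser_deriv_sums[of ?h f z, OF s z]
  let ?g = "\<lambda>n. case n of 0 \<Rightarrow> 0 | Suc k \<Rightarrow> z * (of_nat k * ?h k * z ^ k + a * (?h k * z ^ k))"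
  \<comment> \<open>The coefficients contributed by the factor \<open>z\<close>, moved up by one index.\<close>
  have "(\<lambda>k. ?g (Suc k)) sums (z * (z * deriv f z + a * f z))"
    by simp (intro sums_mult sums_add d s z)
  hence g: "?g sums (z * (z * deriv f z + a * f z))"
    by (subst (asm) sums_Suc_iff) simp
  have "(\<lambda>n. (of_nat n * ?h n * z ^ n + (c - b - 1) * (?h n * z ^ n) - ?g n) / (c - b - 1)) sums
     ((z * deriv f z + (c - b - 1) * f z - z * (z * deriv f z + a * f z)) / (c - b - 1))"
    by (intro sums_divide sums_diff sums_add sums_mult s d g z)
  moreover have "(of_nat n * ?h n * z ^ n + (c - b - 1) * (?h n * z ^ n) - ?g n) / (c - b - 1) =
                 hyp_coeff a b c n * z ^ n" for n
  proof (cases n)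
    case (Suc k)
    have "of_nat n * ?h n * z ^ n + (c - b - 1) * (?h n * z ^ n) - ?g n =
          ((of_nat (Suc k) + c - b - 1) * ?h (Suc k) - (of_nat k + a) * ?h k) * z ^ Suc k"
      unfolding Suc by (simp add: algebra_simps)
    thus ?thesis using cb unfolding hyp_coeff_lower_b[OF c] Suc by simp
  qed (use cb in simp)
  moreover have "z * deriv f z + (c - b - 1) * f z - z * (z * deriv f z + a * f z) =
      z * (1 - z) * deriv f z + (c - b - 1 - a * z) * f z"
    by (simp add: algebra_simps)
  ultimately show "(\<lambda>n. hyp_coeff a b c n * z ^ n) sums
      ((z * (1 - z) * deriv f z + (c - b - 1 - a * z) * f z) / (c - b - 1))" by simp
qed

text \<open>
  By Weierstrass, \<open>u\<close> is a uniform limit of polynomials, and each polynomial is orthogonal to \<open>u\<close>;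
  hence \<open>u\<close> is orthogonal to itself.
\<close>
lemma moments_zero_imp_zero:
  fixes u :: "real \<Rightarrow> real"
  assumes u: "continuous_on {0..1} u"
    and mom: "\<And>n. integral {0..1} (\<lambda>t. u t * t ^ n) = 0"
    and x: "x \<in> {0..1}"
  shows "u x = 0"
proof -
  define I where "I = integral {0..1} (\<lambda>t. u t * u t)"
  define B where "B = integral {0..1} (\<lambda>t. \<bar>u t\<bar>)"
  have B: "B \<ge> 0" unfolding B_def by (rule integral_nonneg) (auto intro!: integrable_continuous_real continuous_intros u)
  have le: "I \<le> e * B" if e: "e > 0" for e
  proof -
    obtain g where g: "polynomial_function g" "\<And>t. t \<in> {0..1} \<Longrightarrow> norm (u t - g t) < e"
      using Stone_Weierstrass_polynomial_function[OF compact_Icc u e] by blast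
    from g(1) obtain q n where q: "g = (\<lambda>t. \<Sum>i\<le>n. q i * t ^ i)"
      by (auto simp: real_polynomial_function_eq[symmetric] real_polynomial_function_iff_sum)
    have cg: "continuous_on {0..1} g" unfolding q by (intro continuous_intros)
    have "integral {0..1} (\<lambda>t. u t * g t) = integral {0..1} (\<lambda>t. \<Sum>i\<le>n. q i * (u t * t ^ i))"
      by (simp add: q sum_distrib_left mult_ac)
    also have "\<dots> = (\<Sum>i\<le>n. integral {0..1} (\<lambda>t. q i * (u t * t ^ i)))"
      by (intro integral_sum) (auto intro!: integrable_continuous_real continuous_intros u)
    also have "\<dots> = 0" by (simp add: mom)
    finally have 0: "integral {0..1} (\<lambda>t. u t * g t) = 0" .
    have "I = I - integral {0..1} (\<lambda>t. u t * g t)" using 0 by simp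
    also have "\<dots> = integral {0..1} (\<lambda>t. u t * u t - u t * g t)"
      unfolding I_def
      by (intro integral_diff[symmetric]) (auto intro!: integrable_continuous_real continuous_intros u cg)
    also have "\<dots> \<le> integral {0..1} (\<lambda>t. e * \<bar>u t\<bar>)"
    proof (rule integral_le)
      fix t :: real assume "t \<in> {0..1}"
      hence "\<bar>u t\<bar> * \<bar>u t - g t\<bar> \<le> \<bar>u t\<bar> * e" using g(2)[of t] by (intro mult_left_mono) auto
      moreover have "u t * u t - u t * g t \<le> \<bar>u t\<bar> * \<bar>u t - g t\<bar>"
        by (metis abs_ge_self abs_mult right_diff_distrib)
      ultimately show "u t * u t - u t * g t \<le> e * \<bar>u t\<bar>" by (simp add: mult.commute)
    qed (auto intro!: integrable_continuous_real continuous_intros u cg)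
    also have "\<dots> = e * B" by (simp add: B_def)
    finally show ?thesis .
  qed
  have I0: "I \<ge> 0" unfolding I_def by (rule integral_nonneg) (auto intro!: integrable_continuous_real continuous_intros u)
  have "I \<le> 0"
  proof (rule field_le_epsilon)
    fix e :: real assume e: "e > 0"
    have "I \<le> e / (B + 1) * B" using e B by (intro le) simp
    also have "\<dots> \<le> e" using e B by (simp add: field_simps)
    finally show "I \<le> 0 + e" by simp
  qed
  with I0 have "I = 0" by simp
  moreover have "((\<lambda>t. u t * u t) has_integral I) {0..1}"
    unfolding I_def
    by (intro integrable_integral integrable_continuous_real continuous_intros u)
  ultimately have int0: "((\<lambda>t. u t * u t) has_integral 0) (cbox 0 1)" by simp
  have "u x * u x = 0"
    by (rule has_integral_0_cbox_imp_0[OF _ _ int0])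
       (use x in \<open>auto intro!: continuous_intros u\<close>)
  thus ?thesis by simp
qed

lemma continuous_on_powr_const:
  fixes g :: "'a :: t2_space \<Rightarrow> complex"
  assumes "continuous_on S g" "\<And>p. p \<in> S \<Longrightarrow> g p \<notin> \<real>\<^sub>\<le>\<^sub>0"
  shows "continuous_on S (\<lambda>p. g p powr s)"
  using assms(1)
proof (rule continuous_on_powr_complex[rotated 2])
  show "S \<subseteq> {z. Re (g z) \<ge> 0 \<or> Im (g z) \<noteq> 0}"
    using assms(2) by (force simp: complex_nonpos_Reals_iff)
  show "Re s > 0" if "p \<in> S" "g p = 0" for p
    using assms(2)[OF that(1)] that(2) by simp
qed simp

text \<open>
  Both exponents in the weight of Euler's integral have positive real part under these bounds, so
  that the weight is continuous on the closed interval and vanishes at its ends.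
\<close>
locale euler_integral =
  fixes a b c :: complex
  assumes Re_b: "Re b > 1" and Re_cb: "Re (c - b) > 1"
begin

lemma c_notin: "c \<notin> \<int>\<^sub>\<le>\<^sub>0"
  using Re_b Re_cb by (intro Re_pos_notin_nonpos_Ints) simp

definition weight :: "real \<Rightarrow> complex" where
  "weight t = of_real t powr (b - 1) * of_real (1 - t) powr (c - b - 1)"

lemma continuous_weight: "continuous_on {0..1} weight"
  unfolding weight_def[abs_def] using Re_b Re_cb
  by (intro continuous_intros continuous_on_powr_complex) auto

definition moment :: "nat \<Rightarrow> complex" where
  "moment n = integral {0..1} (\<lambda>t. weight t * of_real t ^ n)"

lemma has_integral_moment: "((\<lambda>t. weight t * of_real t ^ n) has_integral moment n) {0..1}"
  unfolding moment_def
  by (intro integrable_integral integrable_continuous_real continuous_intros continuous_weight)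

text \<open>
  Integrate the derivative of \<open>t\<^sup>b\<^sup>+\<^sup>n (1 - t)\<^sup>c\<^sup>-\<^sup>b\<close>, which vanishes at both ends.
\<close>
lemma moment_Suc: "(c + of_nat n) * moment (Suc n) = (b + of_nat n) * moment n"
proof -
  define G where "G = (\<lambda>w::complex. w powr b * (1 - w) powr (c - b) * w ^ n)"
  have "((\<lambda>t. (b + of_nat n) * (weight t * of_real t ^ n) - (c + of_nat n) * (weight t * of_real t ^ Suc n))
          has_integral (G (of_real 1) - G (of_real 0))) {0..1}"
  proof (rule fundamental_theorem_of_calculus_interior)
    show "continuous_on {0..1} (\<lambda>t. G (of_real t))"
      unfolding G_def using Re_b Re_cb
      by (intro continuous_intros continuous_on_powr_complex) auto
    fix t :: real assume t: "t \<in> {0<..<1}"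
    define w where "w = complex_of_real t"
    have w: "w \<notin> \<real>\<^sub>\<le>\<^sub>0" "1 - w \<notin> \<real>\<^sub>\<le>\<^sub>0"
      using t by (auto simp: w_def complex_nonpos_Reals_iff)
    have w0: "w \<noteq> 0" "1 - w \<noteq> 0" using w by auto
    have p: "w powr b = w powr (b - 1) * w" "(1 - w) powr (c - b) = (1 - w) powr (c - b - 1) * (1 - w)"
      using w0 powr_add[of w "b - 1" 1] powr_add[of "1 - w" "c - b - 1" 1] by simp_all
    have n: "of_nat n * w ^ (n - Suc 0) * w = of_nat n * w ^ n"
      by (cases n) auto
    have wt: "weight t = w powr (b - 1) * (1 - w) powr (c - b - 1)"
      by (simp add: weight_def w_def)
    have "(G has_field_derivative
       (b * w powr (b - 1)) * (1 - w) powr (c - b) * w ^ n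
       - w powr b * ((c - b) * (1 - w) powr (c - b - 1)) * w ^ n
       + w powr b * (1 - w) powr (c - b) * (of_nat n * w ^ (n - Suc 0))) (at w)"
      unfolding G_def using w
      by (auto intro!: derivative_eq_intros simp: algebra_simps)
    also have "(b * w powr (b - 1)) * (1 - w) powr (c - b) * w ^ n
       - w powr b * ((c - b) * (1 - w) powr (c - b - 1)) * w ^ n
       + w powr b * (1 - w) powr (c - b) * (of_nat n * w ^ (n - Suc 0)) =
       weight t * (b * (1 - w) - (c - b) * w) * w ^ n +
       weight t * (1 - w) * (of_nat n * w ^ (n - Suc 0) * w)"
      unfolding p wt by (simp add: algebra_simps)
    also have "\<dots> = (b + of_nat n) * (weight t * w ^ n) - (c + of_nat n) * (weight t * w ^ Suc n)"
      unfolding n by (simp add: algebra_simps)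
    finally show "((\<lambda>t. G (of_real t)) has_vector_derivative
        (b + of_nat n) * (weight t * of_real t ^ n) - (c + of_nat n) * (weight t * of_real t ^ Suc n)) (at t)"
      unfolding w_def by (rule has_vector_derivative_real_field)
  qed simp
  moreover have "G (of_real 1) = 0" "G (of_real 0) = 0"
    using Re_b Re_cb by (auto simp: G_def)
  ultimately have "((\<lambda>t. (b + of_nat n) * (weight t * of_real t ^ n) - (c + of_nat n) * (weight t * of_real t ^ Suc n))
          has_integral 0) {0..1}" by simp
  moreover have "((\<lambda>t. (b + of_nat n) * (weight t * of_real t ^ n) - (c + of_nat n) * (weight t * of_real t ^ Suc n))
          has_integral ((b + of_nat n) * moment n - (c + of_nat n) * moment (Suc n))) {0..1}"
    by (intro has_integral_diff has_integral_mult_right has_integral_moment)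
  ultimately have "(b + of_nat n) * moment n - (c + of_nat n) * moment (Suc n) = 0"
    by (rule has_integral_unique[symmetric])
  thus ?thesis by simp
qed

lemma moment_eq: "pochhammer c n * moment n = pochhammer b n * moment 0"
proof (induction n)
  case (Suc n)
  have "pochhammer c (Suc n) * moment (Suc n) = pochhammer c n * ((c + of_nat n) * moment (Suc n))"
    by (simp add: pochhammer_Suc mult_ac)
  also have "\<dots> = (b + of_nat n) * (pochhammer c n * moment n)"
    unfolding moment_Suc by (simp only: mult_ac)
  finally show ?case unfolding Suc.IH by (simp add: pochhammer_Suc mult_ac)
qed simp

text \<open>
  The zeroth moment is a Beta value. If it vanished then, by \<open>moment_eq\<close>, so would all moments, and
  therefore the weight itself.
\<close>
lemma moment_0_nonzero: "moment 0 \<noteq> 0"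
proof
  assume 0: "moment 0 = 0"
  have m0: "((\<lambda>t. weight t * of_real t ^ n) has_integral 0) {0..1}" for n
    using has_integral_moment[of n] moment_eq[of n] 0 pochhammer_nonzero[OF c_notin, of n] by simp
  have R: "((\<lambda>t. Re (weight t) * t ^ n) has_integral 0) {0..1}" for n
    using has_integral_Re[OF m0[of n]] by (simp flip: of_real_power)
  have I: "((\<lambda>t. Im (weight t) * t ^ n) has_integral 0) {0..1}" for n
    using has_integral_Im[OF m0[of n]] by (simp flip: of_real_power)
  have "Re (weight (1/2)) = 0"
    by (rule moments_zero_imp_zero[where u = "\<lambda>t. Re (weight t)"])
       (auto intro!: continuous_intros continuous_weight integral_unique R)
  moreover have "Im (weight (1/2)) = 0"
    by (rule moments_zero_imp_zero[where u = "\<lambda>t. Im (weight t)"])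
       (auto intro!: continuous_intros continuous_weight integral_unique I)
  ultimately have "weight (1/2) = 0" by (simp add: complex_eq_iff)
  thus False by (simp add: weight_def)
qed

definition euler :: "complex \<Rightarrow> complex" where
  "euler z = integral {0..1} (\<lambda>t. weight t * (1 - of_real t * z) powr (-a))"

text \<open>
  On the cut plane the principal power in Euler's integrand stays away from its branch cut.
\<close>
lemma one_minus_notin: 
  assumes "z \<in> cut_plane" "t \<in> {0..1}"
  shows "1 - of_real t * z \<notin> \<real>\<^sub>\<le>\<^sub>0"
proof
  assume "1 - of_real t * z \<in> \<real>\<^sub>\<le>\<^sub>0"
  hence *: "t * Im z = 0" "t * Re z \<ge> 1" by (auto simp: complex_nonpos_Reals_iff)
  have t: "t > 0" using * assms(2) by (cases "t = 0") auto
  have "1 \<le> t * Re z" by (rule *)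
  also have "0 < t * Re z" using * by linarith
  hence "Re z > 0" using t by (simp add: zero_less_mult_iff)
  hence "t * Re z \<le> Re z" using assms(2) by (intro mult_left_le_one_le) auto
  finally have "z = of_real (Re z)" "Re z \<in> {1..}" using * t by (auto simp: complex_eq_iff)
  with assms(1) show False by blast
qed

lemma holomorphic_euler: "euler holomorphic_on cut_plane"
proof -
  have "euler field_differentiable (at z)" if z: "z \<in> cut_plane" for z
  proof -
    obtain e where e: "e > 0" "ball z e \<subseteq> cut_plane"
      using z open_cut_plane unfolding open_contains_ball by blast
    have nin: "1 - of_real t * x \<notin> \<real>\<^sub>\<le>\<^sub>0" if "x \<in> ball z e" "t \<in> {0..1}" for x t
      using one_minus_notin that e(2) by blast
    \<comment> \<open>Differentiation under the integral sign needs a convex domain, hence the ball.\<close>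
    have "(\<lambda>z. integral (cbox 0 1) (\<lambda>t. weight t * (1 - of_real t * z) powr (-a))) holomorphic_on ball z e"
    proof (rule leibniz_rule_holomorphic)
      fix x t assume x: "x \<in> ball z e" and t: "t \<in> cbox (0::real) 1"
      show "((\<lambda>x. weight t * (1 - of_real t * x) powr (-a)) has_field_derivative
             weight t * (a * of_real t * (1 - of_real t * x) powr (-a - 1))) (at x within ball z e)"
        using nin[OF x, of t] t
        by (auto intro!: derivative_eq_intros)
    next
      fix x assume x: "x \<in> ball z e"
      show "(\<lambda>t. weight t * (1 - of_real t * x) powr (-a)) integrable_on cbox 0 1"
        unfolding cbox_interval
        by (intro integrable_continuous_real continuous_on_mult continuous_on_powr_const
              continuous_weight nin[OF x] continuous_intros)
    next
      have "continuous_on (ball z e \<times> cbox 0 1)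
         (\<lambda>p. weight (snd p) * (a * of_real (snd p) * (1 - of_real (snd p) * fst p) powr (-a - 1)))"
        by (intro continuous_on_mult continuous_on_powr_const continuous_on_const continuous_on_diff
              continuous_on_of_real continuous_on_fst continuous_on_snd continuous_on_id
              continuous_on_compose2[OF continuous_weight] nin) auto
      thus "continuous_on (ball z e \<times> cbox 0 1)
         (\<lambda>(x, t). weight t * (a * of_real t * (1 - of_real t * x) powr (-a - 1)))"
        by (simp add: case_prod_unfold)
    qed simp
    hence "euler holomorphic_on ball z e"
      unfolding euler_def[abs_def] cbox_interval .
    thus ?thesis using e(1) holomorphic_on_imp_differentiable_at[of euler "ball z e" z] by simp
  qed
  thus ?thesis by (simp add: holomorphic_on_def field_differentiable_at_within)
qed

text \<open>
  Expand the power by the binomial series, which converges uniformly on \<open>[0, 1]\<close>, and integrate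
  term by term; the moments supply the missing quotients of Pochhammer symbols.
\<close>
lemma euler_sums:
  assumes z: "norm z < 1"
  shows "(\<lambda>n. moment 0 * (hyp_coeff a b c n * z ^ n)) sums euler z"
proof -
  define C where "C = (\<lambda>n. pochhammer a n / fact n :: complex)"
  have binom: "(\<lambda>n. C n * w ^ n) sums (1 - w) powr (-a)" if "norm w < 1" for w
  proof -
    have "(\<lambda>n. ((-a) gchoose n) * (-w) ^ n) sums (1 + (-w)) powr (-a)"
      by (rule gen_binomial_complex) (use that in simp)
    moreover have "((-a) gchoose n) * (-w) ^ n = C n * w ^ n" for n
    proof -
      have "(-1 :: complex) ^ n * (-1) ^ n = 1" by (simp flip: power_mult_distrib)
      thus ?thesis
        unfolding gbinomial_pochhammer power_minus[of w] C_def by (simp add: mult_ac)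
    qed
    ultimately show ?thesis by simp
  qed
  obtain W where W: "W > 0" "\<And>t. t \<in> {0..1} \<Longrightarrow> norm (weight t) \<le> W"
  proof -
    have "bounded (weight ` {0..1})"
      by (intro compact_imp_bounded compact_continuous_image continuous_weight) auto
    thus ?thesis using that unfolding bounded_pos by auto
  qed
  have sC: "summable (\<lambda>n. norm (C n * z ^ n))"
  proof -
    obtain r where r: "norm z < r" "r < 1" using z dense by blast
    have "summable (\<lambda>n. C n * (of_real r) ^ n)"
      using binom[of "of_real r"] r order.trans[OF norm_ge_zero less_imp_le[OF r(1)]] by (auto simp: sums_iff)
    thus ?thesis by (rule powser_insidea) (use r in auto)
  qed
  have ul: "uniform_limit {0..1} (\<lambda>N t. \<Sum>n<N. weight t * (C n * (of_real t * z) ^ n))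
              (\<lambda>t. \<Sum>n. weight t * (C n * (of_real t * z) ^ n)) sequentially"
  proof (rule Weierstrass_m_test)
    fix n t assume t: "t \<in> {0..1::real}"
    have "norm (of_real t * z) ^ n \<le> norm z ^ n"
      using t by (intro power_mono) (auto simp: norm_mult intro: mult_left_le_one_le)
    hence "norm (C n * (of_real t * z) ^ n) \<le> norm (C n * z ^ n)"
      unfolding norm_mult norm_power by (intro mult_left_mono) auto
    thus "norm (weight t * (C n * (of_real t * z) ^ n)) \<le> W * norm (C n * z ^ n)"
      unfolding norm_mult[of "weight t"] using W t by (intro mult_mono) auto
  next
    show "summable (\<lambda>n. W * norm (C n * z ^ n))" by (intro summable_mult sC)
  qed
  have cont: "continuous_on {0..1} (\<lambda>t. \<Sum>n<N. weight t * (C n * (of_real t * z) ^ n))" for N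
    by (intro continuous_intros continuous_weight)
  obtain I J where IJ: "\<And>N. ((\<lambda>t. \<Sum>n<N. weight t * (C n * (of_real t * z) ^ n)) has_integral I N) {0..1}"
    "((\<lambda>t. \<Sum>n. weight t * (C n * (of_real t * z) ^ n)) has_integral J) {0..1}" "I \<longlonglongrightarrow> J"
    by (rule uniform_limit_integral[OF ul cont sequentially_bot], rule that)
  have IN: "I N = (\<Sum>n<N. moment 0 * (hyp_coeff a b c n * z ^ n))" for N
  proof -
    have "((\<lambda>t. \<Sum>n<N. (C n * z ^ n) * (weight t * of_real t ^ n)) has_integral
             (\<Sum>n<N. (C n * z ^ n) * moment n)) {0..1}"
      by (intro has_integral_sum has_integral_mult_right has_integral_moment) auto
    also have "(\<lambda>t. \<Sum>n<N. (C n * z ^ n) * (weight t * of_real t ^ n)) =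
               (\<lambda>t. \<Sum>n<N. weight t * (C n * (of_real t * z) ^ n))"
      by (simp add: power_mult_distrib mult_ac)
    finally have "I N = (\<Sum>n<N. (C n * z ^ n) * moment n)"
      by (rule has_integral_unique[OF IJ(1)])
    also have "\<dots> = (\<Sum>n<N. moment 0 * (hyp_coeff a b c n * z ^ n))"
    proof (rule sum.cong)
      fix n
      have "moment n = pochhammer b n * moment 0 / pochhammer c n"
        using moment_eq[of n] pochhammer_nonzero[OF c_notin, of n] by (simp add: field_simps)
      thus "C n * z ^ n * moment n = moment 0 * (hyp_coeff a b c n * z ^ n)"
        by (simp add: C_def hyp_coeff_def mult_ac)
    qed simp
    finally show ?thesis .
  qed
  moreover have "J = euler z"
  proof -
    have "((\<lambda>t. weight t * (1 - of_real t * z) powr (-a)) has_integral J) {0..1}"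
    proof (rule has_integral_eq[OF _ IJ(2)])
      fix t :: real assume t: "t \<in> {0..1}"
      have "norm (of_real t * z) \<le> norm z"
        using t by (auto simp: norm_mult intro: mult_left_le_one_le)
      hence "(\<lambda>n. weight t * (C n * (of_real t * z) ^ n)) sums (weight t * (1 - of_real t * z) powr (-a))"
        using z by (intro sums_mult binom) simp
      thus "(\<Sum>n. weight t * (C n * (of_real t * z) ^ n)) = weight t * (1 - of_real t * z) powr (-a)"
        by (simp add: sums_iff)
    qed
    thus ?thesis unfolding euler_def by (simp add: integral_unique)
  qed
  ultimately show ?thesis using IJ(3) unfolding sums_def IN[symmetric] by simp
qed

lemma hyp_continuation_euler: "hyp_continuation a b c (\<lambda>z. euler z / moment 0)"
  unfolding hyp_continuation_def
proof (intro conjI ballI)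
  show "(\<lambda>z. euler z / moment 0) holomorphic_on cut_plane"
    by (intro holomorphic_intros holomorphic_euler) (simp add: moment_0_nonzero)
  fix z :: complex assume "z \<in> ball 0 1"
  hence "(\<lambda>n. moment 0 * (hyp_coeff a b c n * z ^ n) / moment 0) sums (euler z / moment 0)"
    by (intro sums_divide euler_sums) simp
  thus "(\<lambda>n. hyp_coeff a b c n * z ^ n) sums (euler z / moment 0)"
    using moment_0_nonzero by simp
qed

end

text \<open>
  Raise \<open>b\<close> and then \<open>c\<close> by integers until Euler's integral applies, and come back by the two
  contiguous relations. The descent in \<open>b\<close> takes place while \<open>c\<close> is still raised: then
  \<open>Re (c - b) > 1\<close> before each step, and the divisor, \<open>c\<close> minus the old value of \<open>b\<close>, does not vanish.
\<close>
lemma hyp_continuation_exists: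
  assumes c: "c \<notin> \<int>\<^sub>\<le>\<^sub>0"
  shows "\<exists>f. hyp_continuation a b c f"
proof -
  obtain p :: nat where p: "real p > 1 - Re b" using reals_Archimedean2 by blast
  obtain q :: nat where q: "real q > 1 + Re b + real p - Re c" using reals_Archimedean2 by blast
  have down_b: "\<exists>f. hyp_continuation a (b + of_nat (p - k)) (c + of_nat q) f" if "k \<le> p" for k
    using that
  proof (induction k)
    case 0
    interpret euler_integral a "b + of_nat p" "c + of_nat q"
      using p q by unfold_locales auto
    show ?case using hyp_continuation_euler by auto
  next
    case (Suc k)
    then obtain f where f: "hyp_continuation a (b + of_nat (p - k)) (c + of_nat q) f" by auto
    have pk: "p - k = Suc (p - Suc k)" using Suc.prems by simp
    have "Re (c + of_nat q - (b + of_nat (p - Suc k)) - 1) > 0"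
      using q Suc.prems by (simp add: of_nat_diff)
    hence "c + of_nat q - (b + of_nat (p - Suc k)) - 1 \<noteq> 0" by force
    moreover have "hyp_continuation a (b + of_nat (p - Suc k) + 1) (c + of_nat q) f"
      using f unfolding pk by (simp add: add_ac)
    ultimately show ?case
      using hyp_continuation_lower_b plus_of_nat_notin_nonpos_Ints[OF c, of q] by blast
  qed
  have down_c: "\<exists>f. hyp_continuation a b (c + of_nat (q - k)) f" if "k \<le> q" for k
    using that
  proof (induction k)
    case 0
    show ?case using down_b[of p] by simp
  next
    case (Suc k)
    then obtain f where f: "hyp_continuation a b (c + of_nat (q - k)) f" by auto
    have qk: "q - k = Suc (q - Suc k)" using Suc.prems by simp
    have "hyp_continuation a b (c + of_nat (q - Suc k) + 1) f"
      using f unfolding qk by (simp add: add_ac)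
    thus ?case
      using hyp_continuation_lower_c plus_of_nat_notin_nonpos_Ints[OF c] by blast
  qed
  show ?thesis using down_c[of q] by simp
qed

lemma hyp2F1_continuation:
  assumes "c \<notin> \<int>\<^sub>\<le>\<^sub>0"
  shows "hyp_continuation a b c (hyp2F1 a b c)"
  using someI_ex[OF hyp_continuation_exists[OF assms, of a b]]
  unfolding hyp2F1_def hyp_continuation_def .

section \<open>Summation by parts and Abel's limit theorem\<close>

lemma sum_by_parts:
  fixes S a :: "nat \<Rightarrow> 'a :: comm_ring_1"
  shows "(\<Sum>n<N. (S (Suc n) - S n) * a n) =
         S N * a N - S 0 * a 0 + (\<Sum>n<N. S (Suc n) * (a n - a (Suc n)))"
  by (induction N) (simp_all add: algebra_simps)

text \<open>
  Summation by parts moves the difference onto \<open>1 / (n + \<alpha>)\<close>, whose total variation is finite, while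
  the partial sums of \<open>x\<close> are bounded.
\<close>
lemma summable_divide_linear:
  fixes x :: "nat \<Rightarrow> complex"
  assumes x: "summable x" and \<alpha>: "\<alpha> > 0"
  shows "summable (\<lambda>n. x n / (of_nat n + of_real \<alpha>))"
proof -
  define a where "a = (\<lambda>n. 1 / (real n + \<alpha>))"
  define S where "S = (\<lambda>N. \<Sum>n<N. x n)"
  have S: "S \<longlonglongrightarrow> suminf x" unfolding S_def using x by (rule summable_LIMSEQ)
  obtain B where B: "\<And>N. norm (S N) \<le> B"
    using Bseq_def convergent_imp_Bseq[OF convergentI[OF S]] by blast
  have a0: "a \<longlonglongrightarrow> 0" unfolding a_def by real_asymp
  have dec: "a n - a (Suc n) \<ge> 0" for n
    using \<alpha> by (simp add: a_def field_simps)
  have "summable (\<lambda>n. S (Suc n) * of_real (a n - a (Suc n)))"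
  proof (rule summable_comparison_test')
    show "summable (\<lambda>n. B * (a n - a (Suc n)))"
      by (intro summable_mult telescope_summable'[OF a0])
    show "norm (S (Suc n) * of_real (a n - a (Suc n))) \<le> B * (a n - a (Suc n))" if "n \<ge> 0" for n
      unfolding norm_mult norm_of_real abs_of_nonneg[OF dec] by (intro mult_right_mono B dec)
  qed
  hence "(\<lambda>N. S N * of_real (a N) - S 0 * of_real (a 0) +
            (\<Sum>n<N. S (Suc n) * of_real (a n - a (Suc n)))) \<longlonglongrightarrow>
         suminf x * of_real 0 - S 0 * of_real (a 0) + (\<Sum>n. S (Suc n) * of_real (a n - a (Suc n)))"
    by (intro tendsto_intros S a0 summable_LIMSEQ)
  also have "(\<lambda>N. S N * of_real (a N) - S 0 * of_real (a 0) +
            (\<Sum>n<N. S (Suc n) * of_real (a n - a (Suc n)))) = (\<lambda>N. \<Sum>n<N. x n / (of_nat n + of_real \<alpha>))"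
  proof
    fix N
    have "(\<Sum>n<N. x n / (of_nat n + of_real \<alpha>)) = (\<Sum>n<N. (S (Suc n) - S n) * of_real (a n))"
      by (simp add: S_def a_def)
    also have "\<dots> = S N * of_real (a N) - S 0 * of_real (a 0) +
            (\<Sum>n<N. S (Suc n) * of_real (a n - a (Suc n)))"
      by (subst sum_by_parts) simp
    finally show "S N * of_real (a N) - S 0 * of_real (a 0) +
        (\<Sum>n<N. S (Suc n) * of_real (a n - a (Suc n))) = (\<Sum>n<N. x n / (of_nat n + of_real \<alpha>))" ..
  qed
  finally show ?thesis by (auto simp: summable_def sums_def)
qed

text \<open>
  With \<open>S\<^sub>n\<close> the partial sums of \<open>x\<close> minus their limit, summation by parts gives the difference as
  \<open>(1 - r) \<Sum>n. S\<^sub>n\<^sub>+\<^sub>1 r\<^sup>n\<close>. Finitely many terms are killed by \<open>1 - r\<close>; the others are a weighted mean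
  of small numbers.
\<close>
theorem Abel_limit:
  fixes x :: "nat \<Rightarrow> complex"
  assumes x: "summable x"
  shows "((\<lambda>r. \<Sum>n. x n * of_real r ^ n) \<longlongrightarrow> suminf x) (at_left 1)"
proof -
  define S where "S = (\<lambda>N. (\<Sum>n<N. x n) - suminf x)"
  have S: "S \<longlonglongrightarrow> 0"
    unfolding S_def using tendsto_diff[OF summable_LIMSEQ[OF x] tendsto_const[of "suminf x"]] by simp
  have rep: "summable (\<lambda>n. S (Suc n) * of_real r ^ n)"
    "(\<Sum>n. x n * of_real r ^ n) - suminf x = of_real (1 - r) * (\<Sum>n. S (Suc n) * of_real r ^ n)"
    if r: "0 < r" "r < 1" for r
  proof -
    have r0: "(\<lambda>n. complex_of_real r ^ n) \<longlonglongrightarrow> 0" using r by (intro LIMSEQ_power_zero) auto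
    have sx: "summable (\<lambda>n. x n * of_real r ^ n)"
      by (rule powser_inside[of x 1]) (use x r in auto)
    have eq: "(\<Sum>n<N. S (Suc n) * of_real r ^ n) =
        ((\<Sum>n<N. x n * of_real r ^ n) - S N * of_real r ^ N - suminf x) / of_real (1 - r)" for N
    proof -
      have "(\<Sum>n<N. x n * of_real r ^ n) = (\<Sum>n<N. (S (Suc n) - S n) * of_real r ^ n)"
        by (simp add: S_def)
      also have "\<dots> = S N * of_real r ^ N - S 0 * of_real r ^ 0 +
          (\<Sum>n<N. S (Suc n) * (of_real r ^ n - of_real r ^ Suc n))"
        by (rule sum_by_parts)
      also have "(\<Sum>n<N. S (Suc n) * (of_real r ^ n - of_real r ^ Suc n)) =
          of_real (1 - r) * (\<Sum>n<N. S (Suc n) * of_real r ^ n)"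
        by (simp add: sum_distrib_left algebra_simps)
      finally have "(\<Sum>n<N. x n * of_real r ^ n) - S N * of_real r ^ N - suminf x =
          of_real (1 - r) * (\<Sum>n<N. S (Suc n) * of_real r ^ n)" by (simp add: S_def)
      moreover have "complex_of_real (1 - r) \<noteq> 0" using r by (subst of_real_eq_0_iff) simp
      ultimately show ?thesis by (simp del: of_real_diff)
    qed
    have "complex_of_real (1 - r) \<noteq> 0" using r by (subst of_real_eq_0_iff) simp
    hence "(\<lambda>N. \<Sum>n<N. S (Suc n) * of_real r ^ n) \<longlonglongrightarrow>
       ((\<Sum>n. x n * of_real r ^ n) - 0 * 0 - suminf x) / of_real (1 - r)"
      unfolding eq by (intro tendsto_intros summable_LIMSEQ sx S r0) auto
    hence s: "(\<lambda>n. S (Suc n) * of_real r ^ n) sums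
       (((\<Sum>n. x n * of_real r ^ n) - suminf x) / of_real (1 - r))"
      by (simp add: sums_def)
    thus "summable (\<lambda>n. S (Suc n) * of_real r ^ n)" by (rule sums_summable)
    show "(\<Sum>n. x n * of_real r ^ n) - suminf x = of_real (1 - r) * (\<Sum>n. S (Suc n) * of_real r ^ n)"
      unfolding sums_unique[OF s, symmetric] using \<open>complex_of_real (1 - r) \<noteq> 0\<close>
      by (simp del: of_real_diff)
  qed
  show ?thesis
  proof (rule tendstoI)
    fix e :: real assume e: "e > 0"
    from S have "\<forall>\<^sub>F n in sequentially. norm (S n) < e / 2"
      using e tendstoD[of S 0 sequentially "e / 2"] by (simp add: dist_norm)
    then obtain N where N: "\<And>n. n \<ge> N \<Longrightarrow> norm (S n) < e / 2"
      by (auto simp: eventually_at_top_linorder)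
    define C where "C = (\<Sum>n<N. norm (S (Suc n)))"
    have "((\<lambda>r. (1 - r) * C) \<longlongrightarrow> (1 - 1) * C) (at_left 1)" by (intro tendsto_intros)
    hence "\<forall>\<^sub>F r in at_left 1. (1 - r) * C < e / 2"
      using e by (intro order_tendstoD(2)) auto
    moreover have "\<forall>\<^sub>F r in at_left 1. 0 < r \<and> r < (1::real)"
      using eventually_at_left_real[of 0 1] by simp
    ultimately show "\<forall>\<^sub>F r in at_left 1. dist (\<Sum>n. x n * of_real r ^ n) (suminf x) < e"
    proof eventually_elim
      case (elim r)
      hence r: "0 < r" "r < 1" by auto
      define y where "y = (\<lambda>n. S (Suc n) * complex_of_real r ^ n)"
      have sy: "summable y" unfolding y_def by (rule rep(1)[OF r])
      have "norm (\<Sum>n. y (n + N)) \<le> (\<Sum>n. e / 2 * r ^ n)"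
      proof (rule norm_suminf_le)
        fix n
        have "norm (y (n + N)) = norm (S (Suc (n + N))) * (r ^ n * r ^ N)"
          using r by (simp add: y_def norm_mult norm_power power_add)
        also have "\<dots> \<le> e / 2 * (r ^ n * 1)"
          using r less_imp_le[OF N[of "Suc (n + N)"]] e
          by (intro mult_mono mult_left_mono power_le_one) auto
        finally show "norm (y (n + N)) \<le> e / 2 * r ^ n" by simp
      qed (use r in \<open>auto intro!: summable_mult summable_geometric\<close>)
      also have "\<dots> = e / 2 * (1 / (1 - r))"
        using r by (subst suminf_mult) (auto simp: suminf_geometric summable_geometric)
      finally have tail: "norm (\<Sum>n. y (n + N)) \<le> e / 2 * (1 / (1 - r))" .
      have head: "norm (\<Sum>n<N. y n) \<le> C"
        unfolding C_def
      proof (rule sum_norm_le)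
        fix n
        have "norm (y n) = norm (S (Suc n)) * r ^ n"
          using r by (simp add: y_def norm_mult norm_power)
        also have "\<dots> \<le> norm (S (Suc n)) * 1"
          using r by (intro mult_left_mono power_le_one) auto
        finally show "norm (y n) \<le> norm (S (Suc n))" by simp
      qed
      have "norm (suminf y) \<le> norm (\<Sum>n. y (n + N)) + norm (\<Sum>n<N. y n)"
        unfolding suminf_split_initial_segment[OF sy, of N] by (rule norm_triangle_ineq)
      also have "\<dots> \<le> e / 2 * (1 / (1 - r)) + C" using tail head by (rule add_mono)
      finally have *: "norm (suminf y) \<le> e / 2 * (1 / (1 - r)) + C" .
      have "dist (\<Sum>n. x n * of_real r ^ n) (suminf x) = (1 - r) * norm (suminf y)"
        unfolding dist_norm rep(2)[OF r] y_def[symmetric] norm_mult using r by (simp del: of_real_diff)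
      also have "\<dots> \<le> (1 - r) * (e / 2 * (1 / (1 - r)) + C)"
        using r * by (intro mult_left_mono) auto
      also have "\<dots> = e / 2 + (1 - r) * C" using r by (simp add: field_simps)
      also have "\<dots> < e" using elim by simp
      finally show ?case .
    qed
  qed
qed

section \<open>The contiguous relation for the infinite series\<close>

lemma fps_mult_tendsto:
  fixes A :: "'x \<Rightarrow> complex fps"
  assumes "\<And>s. ((\<lambda>x. fps_nth (A x) s) \<longlongrightarrow> fps_nth B s) F"
  shows "((\<lambda>x. fps_nth (P * A x) s) \<longlongrightarrow> fps_nth (P * B) s) F"
  unfolding fps_mult_nth by (intro tendsto_intros assms)

lemma inverse_linear_tendsto_0: "(\<lambda>N. 1 / (of_nat N + M :: complex)) \<longlonglongrightarrow> 0"
  by (intro tendsto_divide_0[OF tendsto_const] tendsto_add_filterlim_at_infinity'[OF _ tendsto_const]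
            tendsto_of_nat)

lemma linear_quotient_tendsto_1: "(\<lambda>N. (of_nat N + x) / (of_nat N + M :: complex)) \<longlonglongrightarrow> 1"
proof -
  have "(\<lambda>N. 1 + (x - M) * (1 / (of_nat N + M))) \<longlonglongrightarrow> 1 + (x - M) * 0"
    by (intro tendsto_intros inverse_linear_tendsto_0)
  moreover have "\<forall>\<^sub>F N in sequentially. 1 + (x - M) * (1 / (of_nat N + M)) = (of_nat N + x) / (of_nat N + M)"
  proof -
    obtain k :: nat where k: "real k > norm M" using reals_Archimedean2 by blast
    show ?thesis using eventually_ge_at_top[of k]
    proof eventually_elim
      case (elim N)
      have "of_nat N + M \<noteq> 0"
      proof
        assume "of_nat N + M = 0"
        hence "of_nat N = - M" by (simp add: eq_neg_iff_add_eq_0)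
        hence "real N = norm M" by (metis norm_minus_cancel norm_of_nat)
        with k elim show False by simp
      qed
      thus ?case by (simp add: field_simps)
    qed
  qed
  ultimately show ?thesis by (simp add: Lim_transform_eventually)
qed

text \<open>
  The formal expansion in \<open>t\<close> of \<open>\<Sum>n. z\<^sup>n h\<^sub>n / (n + 1 + M + t)\<close>. As a formal object it exists whenever
  its coefficients converge, whether or not the sum is analytic in \<open>t\<close>.
\<close>
definition pole_fps :: "complex \<Rightarrow> complex \<Rightarrow> complex \<Rightarrow> complex \<Rightarrow> complex \<Rightarrow> complex fps" where
  "pole_fps z M a b c = Abs_fps (\<lambda>s. (-1) ^ s * A0 z (Suc s) M a b c)"

lemma pole_sum_tendsto:
  assumes "summable (A0_term z (Suc s) M a b c)"
  shows "(\<lambda>N. fps_nth (pole_sum z a b c M N) s) \<longlonglongrightarrow> fps_nth (pole_fps z M a b c) s"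
proof -
  have "fps_nth (pole_sum z a b c M N) s = (-1) ^ s * (\<Sum>n<N. A0_term z (Suc s) M a b c n)" for N
    unfolding pole_sum_def fps_sum_nth
    by (simp add: shifted_recip_nth sum_distrib_left A0_term_def mult_ac)
  thus ?thesis
    unfolding pole_fps_def A0_def fps_nth_Abs_fps
    by (simp only:) (intro tendsto_intros summable_LIMSEQ assms)
qed

text \<open>
  The passage to the limit is reduced to the inhomogeneity together with the boundary term: only
  their sum has to converge.
\<close>
lemma pole_fps_contiguous_limit:
  assumes c: "c \<notin> \<int>\<^sub>\<le>\<^sub>0" and M: "\<And>n. of_nat n + M \<noteq> 0"
    and sM: "\<And>s. summable (A0_term z (Suc s) M a b c)"
    and sM1: "\<And>s. summable (A0_term z (Suc s) (M - 1) a b c)"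
    and E: "\<And>s. (\<lambda>N. fps_nth (poly_rest z a b c M N +
         fps_const (z ^ N * hyp_coeff a b c N * (c + of_nat N - 1) * of_nat N) *
           shifted_recip (of_nat N + M)) s) \<longlonglongrightarrow> fps_nth EE s"
  shows "fps_const z * (fps_const (M + 1 - a) + fps_X) * (fps_const (M + 1 - b) + fps_X) *
           pole_fps z M a b c =
         (fps_const M + fps_X) * (fps_const (M + 1 - c) + fps_X) * pole_fps z (M - 1) a b c + EE"
proof (rule fps_ext)
  fix s
  show "fps_nth (fps_const z * (fps_const (M + 1 - a) + fps_X) * (fps_const (M + 1 - b) + fps_X) *
           pole_fps z M a b c) s =
        fps_nth ((fps_const M + fps_X) * (fps_const (M + 1 - c) + fps_X) * pole_fps z (M - 1) a b c + EE) s"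
  proof (rule LIMSEQ_unique)
    show "(\<lambda>N. fps_nth (fps_const z * (fps_const (M + 1 - a) + fps_X) *
        (fps_const (M + 1 - b) + fps_X) * pole_sum z a b c M N) s) \<longlonglongrightarrow>
      fps_nth (fps_const z * (fps_const (M + 1 - a) + fps_X) * (fps_const (M + 1 - b) + fps_X) *
           pole_fps z M a b c) s"
      by (intro fps_mult_tendsto pole_sum_tendsto sM)
    have "(\<lambda>N. fps_nth ((fps_const M + fps_X) * (fps_const (M + 1 - c) + fps_X) *
           pole_sum z a b c (M - 1) N) s + fps_nth (poly_rest z a b c M N +
         fps_const (z ^ N * hyp_coeff a b c N * (c + of_nat N - 1) * of_nat N) *
           shifted_recip (of_nat N + M)) s) \<longlonglongrightarrow>
       fps_nth ((fps_const M + fps_X) * (fps_const (M + 1 - c) + fps_X) * pole_fps z (M - 1) a b c) s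
       + fps_nth EE s"
      by (intro tendsto_add fps_mult_tendsto pole_sum_tendsto sM1 E)
    thus "(\<lambda>N. fps_nth (fps_const z * (fps_const (M + 1 - a) + fps_X) *
        (fps_const (M + 1 - b) + fps_X) * pole_sum z a b c M N) s) \<longlonglongrightarrow>
      fps_nth ((fps_const M + fps_X) * (fps_const (M + 1 - c) + fps_X) * pole_fps z (M - 1) a b c + EE) s"
      unfolding pole_sum_contiguous[OF c M] by (simp only: fps_add_nth add.assoc)
  qed
qed

text \<open>
  In the constant coefficient the boundary term supplies the summand \<open>(N + c - 1) h\<^sub>N\<close> of Gauss's
  theorem, up to an error that vanishes with \<open>h\<^sub>N\<close>; in the higher coefficients it vanishes with \<open>h\<^sub>N\<close>.
\<close>
lemma pole_fps_contiguous_1: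
  assumes c: "c \<notin> \<int>\<^sub>\<le>\<^sub>0" and r: "Re (c - a - b) > -1" and M: "\<And>n. of_nat n + M \<noteq> 0"
    and sM: "\<And>s. summable (A0_term 1 (Suc s) M a b c)"
    and sM1: "\<And>s. summable (A0_term 1 (Suc s) (M - 1) a b c)"
  shows "fps_const 1 * (fps_const (M + 1 - a) + fps_X) * (fps_const (M + 1 - b) + fps_X) *
           pole_fps 1 M a b c =
         (fps_const M + fps_X) * (fps_const (M + 1 - c) + fps_X) * pole_fps 1 (M - 1) a b c +
         fps_const (E_plus M a b c)"
proof (rule pole_fps_contiguous_limit[OF c M sM sM1])
  fix s
  let ?h = "hyp_coeff a b c"
  have rest: "poly_rest 1 a b c M N = fps_const ((c - a - b) * (\<Sum>n<N. ?h n))" for N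
  proof (rule fps_ext)
    fix k
    have e: "(fps_const (of_nat n + c - 1 - M) - fps_X) - fps_const 1 * (fps_const (of_nat n + a + b - 1 - M) - fps_X)
        = fps_const (c - a - b)" for n by (simp add: algebra_simps)
    show "fps_nth (poly_rest 1 a b c M N) k = fps_nth (fps_const ((c - a - b) * (\<Sum>n<N. ?h n))) k"
      unfolding poly_rest_def power_one mult_1_left e
      by (auto simp: fps_sum_nth sum_distrib_left mult.commute)
  qed
  have Q: "(\<lambda>N. (of_nat N + (c - 1)) / (of_nat N + M)) \<longlonglongrightarrow> 1"
          "(\<lambda>N. (of_nat N + 0) / (of_nat N + M)) \<longlonglongrightarrow> 1"
    by (rule linear_quotient_tendsto_1)+
  show "(\<lambda>N. fps_nth (poly_rest 1 a b c M N +
       fps_const (1 ^ N * ?h N * (c + of_nat N - 1) * of_nat N) * shifted_recip (of_nat N + M)) s)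
       \<longlonglongrightarrow> fps_nth (fps_const (E_plus M a b c)) s"
  proof (cases s)
    case 0
    have lim: "(\<lambda>N. ((c - a - b) * (\<Sum>n<N. ?h n) + (of_nat N + c - 1) * ?h N) -
               M * ?h N * ((of_nat N + (c - 1)) / (of_nat N + M)))
          \<longlonglongrightarrow> gauss_sum a b c - M * 0 * 1"
      by (intro tendsto_intros gauss_sum_LIMSEQ[OF c r] hyp_coeff_tendsto_0[OF c r] Q)
    have eq: "((c - a - b) * (\<Sum>n<N. ?h n) + (of_nat N + c - 1) * ?h N) -
               M * ?h N * ((of_nat N + (c - 1)) / (of_nat N + M)) =
         (c - a - b) * (\<Sum>n<N. ?h n) + ?h N * (c + of_nat N - 1) * of_nat N / (of_nat N + M)" for N
      using M[of N] by (simp add: divide_simps) (simp add: algebra_simps)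
    show ?thesis
      using lim unfolding eq using 0
      by (simp add: rest shifted_recip_nth gauss_sum_eq_E_plus[OF c r, of M])
  next
    case (Suc k)
    have lim: "(\<lambda>N. (-1) ^ s * (?h N * ((of_nat N + (c - 1)) / (of_nat N + M)) * ((of_nat N + 0) / (of_nat N + M)) *
             (1 / (of_nat N + M)) ^ k)) \<longlonglongrightarrow> (-1) ^ s * (0 * 1 * 1 * 0 ^ k)"
      by (intro tendsto_intros hyp_coeff_tendsto_0[OF c r] Q inverse_linear_tendsto_0)
    have eq: "(-1) ^ s * (?h N * ((of_nat N + (c - 1)) / (of_nat N + M)) * ((of_nat N + 0) / (of_nat N + M)) *
             (1 / (of_nat N + M)) ^ k) =
          ?h N * (c + of_nat N - 1) * of_nat N * ((-1) ^ s / (of_nat N + M) ^ Suc s)" for N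
    proof -
      have "of_nat N + (c - 1) = c + of_nat N - 1" by simp
      thus ?thesis unfolding Suc by (simp only:) (simp add: power_divide mult_ac)
    qed
    show ?thesis
      using lim unfolding eq using Suc by (simp add: rest shifted_recip_nth)
  qed
qed

text \<open>
  On the radius towards \<open>-1\<close> the series becomes a power series in \<open>r\<close> with the terms at \<open>-1\<close> as
  coefficients, the form required by Abel's theorem.
\<close>
lemma A0_term_scale: "A0_term (- of_real r) k M a b c n = A0_term (-1) k M a b c n * of_real r ^ n"
  by (simp add: A0_term_def power_minus[of "of_real r"])

text \<open>
  Inside the disc the quotients sum to the hypergeometric function and its derivative, and the
  boundary term vanishes because \<open>n h\<^sub>n z\<^sup>n\<close> is the general term of a convergent series.
\<close>
lemma pole_fps_contiguous_disc:
  assumes c: "c \<notin> \<int>\<^sub>\<le>\<^sub>0" and z: "norm z < 1" and M: "\<And>n. of_nat n + M \<noteq> 0"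
    and sM: "\<And>s. summable (A0_term z (Suc s) M a b c)"
    and sM1: "\<And>s. summable (A0_term z (Suc s) (M - 1) a b c)"
  shows "fps_const z * (fps_const (M + 1 - a) + fps_X) * (fps_const (M + 1 - b) + fps_X) *
           pole_fps z M a b c =
         (fps_const M + fps_X) * (fps_const (M + 1 - c) + fps_X) * pole_fps z (M - 1) a b c +
         (fps_const ((1 - z) * (z * deriv (hyp2F1 a b c) z) +
                     ((c - 1 - M) - z * (a + b - 1 - M)) * hyp2F1 a b c z) +
          fps_const ((z - 1) * hyp2F1 a b c z) * fps_X)"
proof (rule pole_fps_contiguous_limit[OF c M sM sM1])
  fix s
  let ?h = "hyp_coeff a b c" and ?f = "hyp2F1 a b c"
  have zb: "z \<in> ball 0 1" using z by simp
  have ser: "(\<lambda>n. ?h n * w ^ n) sums ?f w" if "w \<in> ball 0 1" for w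
    using hyp2F1_continuation[OF c, of a b] that by (auto simp: hyp_continuation_def)
  have der: "(\<lambda>n. of_nat n * ?h n * z ^ n) sums (z * deriv ?f z)"
    by (rule powser_deriv_sums[OF ser zb])
  have rest: "poly_rest z a b c M N =
      fps_const (\<Sum>n<N. (1 - z) * (of_nat n * ?h n * z ^ n) +
                       ((c - 1 - M) - z * (a + b - 1 - M)) * (?h n * z ^ n)) +
      fps_const (\<Sum>n<N. (z - 1) * (?h n * z ^ n)) * fps_X" for N
  proof (induction N)
    case (Suc N)
    have "(fps_const (of_nat N + c - 1 - M) - fps_X) - fps_const z * (fps_const (of_nat N + a + b - 1 - M) - fps_X)
        = fps_const ((of_nat N + c - 1 - M) - z * (of_nat N + a + b - 1 - M)) + fps_const (z - 1) * fps_X"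
      by (simp add: algebra_simps flip: fps_const_add fps_const_sub fps_const_mult)
    hence "fps_const (z ^ N * ?h N) * ((fps_const (of_nat N + c - 1 - M) - fps_X) -
              fps_const z * (fps_const (of_nat N + a + b - 1 - M) - fps_X)) =
        fps_const (z ^ N * ?h N * ((of_nat N + c - 1 - M) - z * (of_nat N + a + b - 1 - M))) +
        fps_const (z ^ N * ?h N * (z - 1)) * fps_X"
      by (simp only: distrib_left fps_const_mult mult.assoc[symmetric])
    also have "z ^ N * ?h N * ((of_nat N + c - 1 - M) - z * (of_nat N + a + b - 1 - M)) =
        (1 - z) * (of_nat N * ?h N * z ^ N) + ((c - 1 - M) - z * (a + b - 1 - M)) * (?h N * z ^ N)"
      by (simp add: algebra_simps)
    also have "z ^ N * ?h N * (z - 1) = (z - 1) * (?h N * z ^ N)" by (simp add: mult_ac)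
    finally have step: "fps_const (z ^ N * ?h N) * ((fps_const (of_nat N + c - 1 - M) - fps_X) -
              fps_const z * (fps_const (of_nat N + a + b - 1 - M) - fps_X)) =
        fps_const ((1 - z) * (of_nat N * ?h N * z ^ N) + ((c - 1 - M) - z * (a + b - 1 - M)) * (?h N * z ^ N)) +
        fps_const ((z - 1) * (?h N * z ^ N)) * fps_X" .
    show ?case
      using Suc.IH unfolding poly_rest_def sum.lessThan_Suc step
      by (simp only: fps_const_add[symmetric] distrib_right) (simp only: ac_simps)
  qed (simp add: poly_rest_def)
  define e0 where "e0 = (1 - z) * (z * deriv ?f z) + ((c - 1 - M) - z * (a + b - 1 - M)) * ?f z"
  define e1 where "e1 = (z - 1) * ?f z"
  have s0: "(\<lambda>N. \<Sum>n<N. (1 - z) * (of_nat n * ?h n * z ^ n) +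
                ((c - 1 - M) - z * (a + b - 1 - M)) * (?h n * z ^ n)) \<longlonglongrightarrow> e0"
    unfolding e0_def sums_def[symmetric] by (intro sums_add sums_mult der ser zb)
  have s1: "(\<lambda>N. \<Sum>n<N. (z - 1) * (?h n * z ^ n)) \<longlonglongrightarrow> e1"
    unfolding e1_def sums_def[symmetric] by (intro sums_mult ser zb)
  have "(\<lambda>N. (of_nat N * ?h N * z ^ N) * ((of_nat N + (c - 1)) / (of_nat N + M)) *
             ((-1) ^ s * (1 / (of_nat N + M)) ^ s)) \<longlonglongrightarrow> 0 * 1 * ((-1) ^ s * 0 ^ s)"
    by (intro tendsto_intros summable_LIMSEQ_zero sums_summable[OF der]
          linear_quotient_tendsto_1 inverse_linear_tendsto_0)
  moreover have "(of_nat N * ?h N * z ^ N) * ((of_nat N + (c - 1)) / (of_nat N + M)) *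
             ((-1) ^ s * (1 / (of_nat N + M)) ^ s) =
        fps_nth (fps_const (z ^ N * ?h N * (c + of_nat N - 1) * of_nat N) *
           shifted_recip (of_nat N + M)) s" for N
  proof -
    have "of_nat N + (c - 1) = c + of_nat N - 1" by simp
    thus ?thesis by (simp only:) (simp add: shifted_recip_nth power_divide mult_ac)
  qed
  ultimately have bd: "(\<lambda>N. fps_nth (fps_const (z ^ N * ?h N * (c + of_nat N - 1) * of_nat N) *
           shifted_recip (of_nat N + M)) s) \<longlonglongrightarrow> 0" by simp
  have "(\<lambda>N. fps_nth (fps_const (\<Sum>n<N. (1 - z) * (of_nat n * ?h n * z ^ n) +
                       ((c - 1 - M) - z * (a + b - 1 - M)) * (?h n * z ^ n))) s +
             fps_nth (fps_const (\<Sum>n<N. (z - 1) * (?h n * z ^ n)) * fps_X) s) \<longlonglongrightarrow>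
        fps_nth (fps_const e0) s + fps_nth (fps_const e1 * fps_X) s"
  proof (rule tendsto_add)
    show "(\<lambda>N. fps_nth (fps_const (\<Sum>n<N. (1 - z) * (of_nat n * ?h n * z ^ n) +
                       ((c - 1 - M) - z * (a + b - 1 - M)) * (?h n * z ^ n))) s)
          \<longlonglongrightarrow> fps_nth (fps_const e0) s"
      using s0 by (cases "s = 0") auto
    show "(\<lambda>N. fps_nth (fps_const (\<Sum>n<N. (z - 1) * (?h n * z ^ n)) * fps_X) s)
          \<longlonglongrightarrow> fps_nth (fps_const e1 * fps_X) s"
      using s1 by (cases "s = 1") auto
  qed
  from tendsto_add[OF this bd]
  show "(\<lambda>N. fps_nth (poly_rest z a b c M N +
         fps_const (z ^ N * ?h N * (c + of_nat N - 1) * of_nat N) * shifted_recip (of_nat N + M)) s)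
     \<longlonglongrightarrow> fps_nth (fps_const ((1 - z) * (z * deriv ?f z) +
                     ((c - 1 - M) - z * (a + b - 1 - M)) * ?f z) +
          fps_const ((z - 1) * ?f z) * fps_X) s"
    unfolding rest fps_add_nth e0_def e1_def by simp
qed

lemma pole_fps_Abel:
  assumes "summable (A0_term (-1) (Suc s) M a b c)"
  shows "((\<lambda>r. fps_nth (pole_fps (- of_real r) M a b c) s) \<longlongrightarrow> fps_nth (pole_fps (-1) M a b c) s) (at_left 1)"
  unfolding pole_fps_def fps_nth_Abs_fps A0_def A0_term_scale
  by (intro tendsto_intros Abel_limit assms)

text \<open>
  The limit \<open>r \<rightarrow> 1\<close> of the preceding relation at \<open>z = -r\<close>. At \<open>z = -1\<close> the constant coefficient of
  the inhomogeneity is \<open>E\<^sub>-(M)\<close>, and its linear coefficient is the slope of \<open>E\<^sub>-\<close> as a function of \<open>M\<close>.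
\<close>
lemma pole_fps_contiguous_minus_1:
  assumes c: "c \<notin> \<int>\<^sub>\<le>\<^sub>0" and M: "\<And>n. of_nat n + M \<noteq> 0"
    and sM: "\<And>s. summable (A0_term (-1) (Suc s) M a b c)"
    and sM1: "\<And>s. summable (A0_term (-1) (Suc s) (M - 1) a b c)"
  shows "fps_const (-1) * (fps_const (M + 1 - a) + fps_X) * (fps_const (M + 1 - b) + fps_X) *
           pole_fps (-1) M a b c =
         (fps_const M + fps_X) * (fps_const (M + 1 - c) + fps_X) * pole_fps (-1) (M - 1) a b c +
         (fps_const (E_minus M a b c) + fps_const (-2 * hyp2F1 a b c (-1)) * fps_X)"
proof (rule fps_ext)
  fix s
  let ?f = "hyp2F1 a b c"
  let ?P = "(fps_const (M + 1 - a) + fps_X) * (fps_const (M + 1 - b) + fps_X)"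
  let ?Q = "(fps_const M + fps_X) * (fps_const (M + 1 - c) + fps_X)"
  let ?z = "\<lambda>r. - complex_of_real r"
  define e0 where "e0 = (\<lambda>z. (1 - z) * (z * deriv ?f z) + ((c - 1 - M) - z * (a + b - 1 - M)) * ?f z)"
  define e1 where "e1 = (\<lambda>z. (z - 1) * ?f z)"
  have hol: "?f holomorphic_on cut_plane"
    using hyp2F1_continuation[OF c, of a b] by (simp add: hyp_continuation_def)
  have m1: "-1 \<in> cut_plane" by (auto simp: complex_eq_iff)
  have cf: "isCont ?f (-1)" "isCont (deriv ?f) (-1)"
    using hol holomorphic_deriv[OF hol open_cut_plane] m1 open_cut_plane
    by (meson continuous_on_eq_continuous_at holomorphic_on_imp_continuous_on)+
  have z: "(?z \<longlongrightarrow> -1) (at_left 1)" by (auto intro!: tendsto_eq_intros)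
  have f: "((\<lambda>r. ?f (?z r)) \<longlongrightarrow> ?f (-1)) (at_left 1)"
          "((\<lambda>r. deriv ?f (?z r)) \<longlongrightarrow> deriv ?f (-1)) (at_left 1)"
    using cf z by (auto intro: isCont_tendsto_compose)
  have e0: "((\<lambda>r. e0 (?z r)) \<longlongrightarrow> e0 (-1)) (at_left 1)"
    unfolding e0_def by (intro tendsto_intros f z)
  have e1: "((\<lambda>r. e1 (?z r)) \<longlongrightarrow> e1 (-1)) (at_left 1)"
    unfolding e1_def by (intro tendsto_intros f z)
  have e_1: "e0 (-1) = E_minus M a b c" "e1 (-1) = -2 * ?f (-1)"
    by (simp_all add: e0_def e1_def E_minus_def algebra_simps)
  have "((\<lambda>r. ?z r * fps_nth (?P * pole_fps (?z r) M a b c) s) \<longlongrightarrow>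
          (-1) * fps_nth (?P * pole_fps (-1) M a b c) s) (at_left 1)"
    by (intro tendsto_mult z fps_mult_tendsto pole_fps_Abel sM)
  moreover have "((\<lambda>r. fps_nth (?Q * pole_fps (?z r) (M - 1) a b c) s +
            (fps_nth (fps_const (e0 (?z r))) s + fps_nth (fps_const (e1 (?z r)) * fps_X) s)) \<longlongrightarrow>
        fps_nth (?Q * pole_fps (-1) (M - 1) a b c) s +
            (fps_nth (fps_const (e0 (-1))) s + fps_nth (fps_const (e1 (-1)) * fps_X) s)) (at_left 1)"
  proof (intro tendsto_add fps_mult_tendsto pole_fps_Abel sM1)
    show "((\<lambda>r. fps_nth (fps_const (e0 (?z r))) s) \<longlongrightarrow> fps_nth (fps_const (e0 (-1))) s) (at_left 1)"
      using e0 by (cases "s = 0") auto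
    show "((\<lambda>r. fps_nth (fps_const (e1 (?z r)) * fps_X) s) \<longlongrightarrow> fps_nth (fps_const (e1 (-1)) * fps_X) s) (at_left 1)"
      using e1 by (cases "s = 1") auto
  qed
  moreover have "\<forall>\<^sub>F r in at_left 1.
      fps_nth (?Q * pole_fps (?z r) (M - 1) a b c) s +
            (fps_nth (fps_const (e0 (?z r))) s + fps_nth (fps_const (e1 (?z r)) * fps_X) s) =
      ?z r * fps_nth (?P * pole_fps (?z r) M a b c) s"
  proof -
    have "\<forall>\<^sub>F r in at_left 1. 0 < r \<and> r < (1::real)"
      using eventually_at_left_real[of 0 1] by simp
    thus ?thesis
    proof eventually_elim
      case (elim r)
      have sr: "summable (A0_term (?z r) (Suc s) N a b c)"
        if "summable (A0_term (-1) (Suc s) N a b c)" for s N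
        unfolding A0_term_scale[abs_def]
        by (rule powser_inside[of _ 1]) (use that elim in auto)
      have "fps_const (?z r) * ?P * pole_fps (?z r) M a b c = ?Q * pole_fps (?z r) (M - 1) a b c +
          (fps_const (e0 (?z r)) + fps_const (e1 (?z r)) * fps_X)"
        using pole_fps_contiguous_disc[OF c _ M sr[OF sM] sr[OF sM1]] elim
        unfolding e0_def e1_def by (simp add: mult.assoc)
      hence "fps_nth (fps_const (?z r) * (?P * pole_fps (?z r) M a b c)) s =
          fps_nth (?Q * pole_fps (?z r) (M - 1) a b c +
          (fps_const (e0 (?z r)) + fps_const (e1 (?z r)) * fps_X)) s"
        by (simp only: mult.assoc)
      thus ?case unfolding fps_add_nth fps_mult_left_const_nth ..
    qed
  qed
  ultimately have "(-1) * fps_nth (?P * pole_fps (-1) M a b c) s =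
     fps_nth (?Q * pole_fps (-1) (M - 1) a b c) s +
            (fps_nth (fps_const (e0 (-1))) s + fps_nth (fps_const (e1 (-1)) * fps_X) s)"
    by (intro tendsto_unique[OF trivial_limit_at_left_real _ Lim_transform_eventually])
  thus "fps_nth (fps_const (-1) * (fps_const (M + 1 - a) + fps_X) * (fps_const (M + 1 - b) + fps_X) *
           pole_fps (-1) M a b c) s =
         fps_nth (?Q * pole_fps (-1) (M - 1) a b c +
         (fps_const (E_minus M a b c) + fps_const (-2 * ?f (-1)) * fps_X)) s"
    unfolding e_1 mult.assoc[of "fps_const (-1)"] fps_add_nth fps_mult_left_const_nth .
qed

text \<open>
  Convergence at one shift and for simple denominators propagates to shifts larger by an integer
  and to all powers, even where it is only conditional, because every step divides by a linear term.
\<close>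
lemma summable_A0_term_shift:
  assumes x: "summable (A0_term z 1 (of_real \<alpha>) a b c)" and \<alpha>: "\<alpha> > -1"
  shows "summable (A0_term z (Suc s) (of_real \<alpha> + of_nat j) a b c)"
proof (induction s)
  case 0
  have nz: "complex_of_real (real n + 1 + \<alpha>) \<noteq> 0" "complex_of_real (real n + 1 + (\<alpha> + real j)) \<noteq> 0" for n
    using \<alpha> by (simp_all only: of_real_eq_0_iff)
  \<comment> \<open>The quotient of the two denominators is \<open>1 - j / (n + 1 + \<alpha> + j)\<close>.\<close>
  have "summable (\<lambda>n. A0_term z 1 (of_real \<alpha>) a b c n - of_nat j *
          (A0_term z 1 (of_real \<alpha>) a b c n / (of_nat n + of_real (\<alpha> + real j + 1))))"
    using \<alpha> by (intro summable_diff summable_mult x summable_divide_linear) auto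
  moreover have "A0_term z 1 (of_real \<alpha>) a b c n - of_nat j *
          (A0_term z 1 (of_real \<alpha>) a b c n / (of_nat n + of_real (\<alpha> + real j + 1))) =
          A0_term z (Suc 0) (of_real \<alpha> + of_nat j) a b c n" for n
    using nz[of n] by (simp add: A0_term_def divide_simps) (simp add: algebra_simps)
  ultimately show ?case by simp
next
  case (Suc s)
  have "summable (\<lambda>n. A0_term z (Suc s) (of_real \<alpha> + of_nat j) a b c n / (of_nat n + of_real (\<alpha> + real j + 1)))"
    using \<alpha> by (intro summable_divide_linear Suc.IH) simp
  also have "(\<lambda>n. A0_term z (Suc s) (of_real \<alpha> + of_nat j) a b c n / (of_nat n + of_real (\<alpha> + real j + 1))) =
             A0_term z (Suc (Suc s)) (of_real \<alpha> + of_nat j) a b c"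
    by (simp add: A0_term_def fun_eq_iff add_ac mult_ac)
  finally show ?case .
qed

lemma summable_A0_term_1:
  assumes c: "c \<notin> \<int>\<^sub>\<le>\<^sub>0" and r: "Re (c - a - b) > -1" and \<alpha>: "\<alpha> > -1"
  shows "summable (A0_term 1 1 (of_real \<alpha>) a b c)"
proof -
  have "summable (\<lambda>n. A0_term 1 1 (of_real \<alpha>) a b c (Suc n))"
  proof (rule summable_comparison_test'[OF hyp_coeff_over_n_summable(2)[OF c r]])
    fix n :: nat
    have "norm (of_nat (Suc n) + 1 + complex_of_real \<alpha>) = real (Suc n) + 1 + \<alpha>"
      using \<alpha> norm_of_real[of "real (Suc n) + 1 + \<alpha>", where 'a=complex] by simp
    thus "norm (A0_term 1 1 (of_real \<alpha>) a b c (Suc n)) \<le> norm (hyp_coeff a b c (Suc n)) / real (Suc n)"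
      unfolding A0_term_def norm_divide power_one_right power_one mult_1_left
      using \<alpha> by (auto intro!: divide_left_mono)
  qed
  thus ?thesis by (subst (asm) summable_Suc_iff)
qed

section \<open>Iteration of the relation\<close>

text \<open>
  The relation solved for the series with shift \<open>M\<close> reads \<open>F(M) = step_factor * F(M - 1) +
  step_inhom * E(M)\<close>. Both factors are formal expansions in the increment of \<open>M\<close>.
\<close>
definition step_inhom :: "complex \<Rightarrow> complex \<Rightarrow> complex \<Rightarrow> complex \<Rightarrow> complex fps" where
  "step_inhom \<epsilon> a b M = fps_const \<epsilon> * inverse (fps_const (M + 1 - a) + fps_X) * inverse (fps_const (M + 1 - b) + fps_X)"

definition step_factor :: "complex \<Rightarrow> complex \<Rightarrow> complex \<Rightarrow> complex \<Rightarrow> complex \<Rightarrow> complex fps" where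
  "step_factor \<epsilon> a b c M = step_inhom \<epsilon> a b M * ((fps_const M + fps_X) * (fps_const (M + 1 - c) + fps_X))"

definition E_fps :: "complex \<Rightarrow> complex \<Rightarrow> complex \<Rightarrow> complex \<Rightarrow> complex \<Rightarrow> complex fps" where
  "E_fps \<epsilon> M a b c = (if \<epsilon> = 1 then fps_const (E_plus M a b c)
     else fps_const (E_minus M a b c) + fps_const (-2 * hyp2F1 a b c (-1)) * fps_X)"

lemma E_eps_has_fps_expansion:
  "(\<lambda>t. E_eps \<epsilon> (M + t) a b c) has_fps_expansion E_fps \<epsilon> M a b c"
proof (cases "\<epsilon> = 1")
  case True
  thus ?thesis by (simp add: E_eps_def E_fps_def E_plus_def[abs_def])
next
  case False
  have "(\<lambda>t. E_minus M a b c + (-2 * hyp2F1 a b c (-1)) * t) has_fps_expansion E_fps \<epsilon> M a b c"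
    unfolding E_fps_def if_not_P[OF False] by (intro fps_expansion_intros)
  also have "(\<lambda>t. E_minus M a b c + (-2 * hyp2F1 a b c (-1)) * t) = (\<lambda>t. E_eps \<epsilon> (M + t) a b c)"
    using False by (simp add: E_eps_def E_minus_def fun_eq_iff algebra_simps)
  finally show ?thesis .
qed

lemma step_inhom_has_fps_expansion:
  assumes "M + 1 - a \<noteq> 0" "M + 1 - b \<noteq> 0"
  shows "(\<lambda>t. \<epsilon> / ((M + 1 - a + t) * (M + 1 - b + t))) has_fps_expansion step_inhom \<epsilon> a b M"
proof -
  have "(\<lambda>t. \<epsilon> * inverse (M + 1 - a + t) * inverse (M + 1 - b + t)) has_fps_expansion step_inhom \<epsilon> a b M"
    unfolding step_inhom_def using assms by (intro fps_expansion_intros) auto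
  thus ?thesis by (simp add: field_simps)
qed

lemma step_factor_has_fps_expansion:
  assumes "M + 1 - a \<noteq> 0" "M + 1 - b \<noteq> 0"
  shows "(\<lambda>t. \<epsilon> / ((M + 1 - a + t) * (M + 1 - b + t)) * ((M + t) * (M + 1 - c + t)))
           has_fps_expansion step_factor \<epsilon> a b c M"
  unfolding step_factor_def
  by (intro fps_expansion_intros step_inhom_has_fps_expansion assms)

lemma Rfun_Suc:
  "Rfun \<epsilon> a b c (Suc l) x = Rfun \<epsilon> a b c l x *
     (\<epsilon> / ((x + of_nat (Suc l) + 1 - a) * (x + of_nat (Suc l) + 1 - b)) *
      ((x + of_nat (Suc l)) * (x + of_nat (Suc l) + 1 - c)))"
proof -
  have *: "x + of_nat (Suc l) + 1 - y = 2 - y + x + of_nat l" "x + of_nat (Suc l) = 1 + x + of_nat l" for y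
    by simp_all
  show ?thesis unfolding *(1) unfolding *(2) by (simp add: Rfun_def pochhammer_Suc mult_ac)
qed

lemma Tfun_Suc:
  assumes "j \<le> l"
  shows "Tfun \<epsilon> a b c (Suc l) j x = Tfun \<epsilon> a b c l j x *
     (\<epsilon> / ((x + of_nat (Suc l) + 1 - a) * (x + of_nat (Suc l) + 1 - b)) *
      ((x + of_nat (Suc l)) * (x + of_nat (Suc l) + 1 - c)))"
proof -
  obtain k where l: "l = j + k" using assms le_Suc_ex by blast
  have *: "x + of_nat (Suc l) + 1 - y = of_nat j + 1 - y + x + of_nat (Suc k)"
          "x + of_nat (Suc l) + 1 - y = of_nat j + 2 - y + x + of_nat k"
          "x + of_nat (Suc l) = of_nat j + 1 + x + of_nat k" for y
    by (simp_all add: l)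
  have d: "l - j = k" "Suc l - j = Suc k" by (simp_all add: l)
  show ?thesis
    unfolding *(1)[of a] *(1)[of b] *(2)[of c] unfolding *(3) Tfun_def d
    by (simp add: pochhammer_Suc mult_ac del: of_nat_Suc)
qed

lemma Tfun_diag:
  "Tfun \<epsilon> a b c l l x = \<epsilon> / ((x + of_nat l + 1 - a) * (x + of_nat l + 1 - b))"
proof -
  have "x + of_nat l + 1 - y = of_nat l + 1 - y + x" for y by simp
  thus ?thesis by (simp only:) (simp add: Tfun_def)
qed


text \<open>
  Together with the next lemma this identifies the products that arise from the iteration with the
  functions \<open>\<R>\<close> and \<open>\<T>\<close> of the theorem.
\<close>
lemma Rfun_has_fps_expansion:
  assumes "\<And>j. j \<in> {1..l} \<Longrightarrow> lam + of_nat j + 1 - a \<noteq> 0 \<and> lam + of_nat j + 1 - b \<noteq> 0"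
  shows "(\<lambda>t. Rfun \<epsilon> a b c l (lam + t)) has_fps_expansion
           (\<Prod>j=1..l. step_factor \<epsilon> a b c (lam + of_nat j))"
  using assms
proof (induction l)
  case 0
  show ?case by (simp add: Rfun_def)
next
  case (Suc l)
  let ?M = "lam + of_nat (Suc l)"
  have IH: "(\<lambda>t. Rfun \<epsilon> a b c l (lam + t)) has_fps_expansion
           (\<Prod>j=1..l. step_factor \<epsilon> a b c (lam + of_nat j))"
    by (rule Suc.IH, rule Suc.prems) auto
  have "?M + 1 - a \<noteq> 0" "?M + 1 - b \<noteq> 0" using Suc.prems[of "Suc l"] by auto
  from has_fps_expansion_mult[OF IH step_factor_has_fps_expansion[OF this, of \<epsilon> c]]
  show ?case
    unfolding Rfun_Suc by (simp add: algebra_simps del: of_nat_Suc)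
qed

lemma Tfun_has_fps_expansion:
  assumes "\<And>i. i \<in> {j..l} \<Longrightarrow> lam + of_nat i + 1 - a \<noteq> 0 \<and> lam + of_nat i + 1 - b \<noteq> 0" "j \<le> l"
  shows "(\<lambda>t. Tfun \<epsilon> a b c l j (lam + t)) has_fps_expansion
           step_inhom \<epsilon> a b (lam + of_nat j) * (\<Prod>i=Suc j..l. step_factor \<epsilon> a b c (lam + of_nat i))"
  using assms(2,1)
proof (induction l rule: dec_induct)
  case base
  have "lam + of_nat j + 1 - a \<noteq> 0" "lam + of_nat j + 1 - b \<noteq> 0" using base[of j] by auto
  from step_inhom_has_fps_expansion[OF this, of \<epsilon>] show ?case
    unfolding Tfun_diag by (simp add: algebra_simps)
next
  case (step l)
  let ?M = "lam + of_nat (Suc l)"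
  have IH: "(\<lambda>t. Tfun \<epsilon> a b c l j (lam + t)) has_fps_expansion
           step_inhom \<epsilon> a b (lam + of_nat j) * (\<Prod>i=Suc j..l. step_factor \<epsilon> a b c (lam + of_nat i))"
    by (rule step.IH, rule step.prems) auto
  have "?M + 1 - a \<noteq> 0" "?M + 1 - b \<noteq> 0" using step.prems[of "Suc l"] step.hyps by auto
  from has_fps_expansion_mult[OF IH step_factor_has_fps_expansion[OF this, of \<epsilon> c]]
  show ?case
    unfolding Tfun_Suc[OF step.hyps(1)] using step.hyps
    by (simp add: algebra_simps del: of_nat_Suc)
qed

lemma iterate_affine_recurrence:
  fixes F \<rho> \<tau> E :: "nat \<Rightarrow> 'a :: comm_ring_1"
  assumes "\<And>j. j < l \<Longrightarrow> F (Suc j) = \<rho> (Suc j) * F j + \<tau> (Suc j) * E (Suc j)"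
  shows "F l = (\<Prod>j=1..l. \<rho> j) * F 0 + (\<Sum>j=1..l. \<tau> j * (\<Prod>i=Suc j..l. \<rho> i) * E j)"
  using assms
proof (induction l)
  case (Suc l)
  have IH: "F l = (\<Prod>j=1..l. \<rho> j) * F 0 + (\<Sum>j=1..l. \<tau> j * (\<Prod>i=Suc j..l. \<rho> i) * E j)"
    using Suc by simp
  have "(\<Sum>j=1..l. \<tau> j * (\<Prod>i=Suc j..Suc l. \<rho> i) * E j) =
        \<rho> (Suc l) * (\<Sum>j=1..l. \<tau> j * (\<Prod>i=Suc j..l. \<rho> i) * E j)"
    unfolding sum_distrib_left by (intro sum.cong) (auto simp: mult_ac)
  thus ?case
    using Suc.prems[of l] unfolding IH by (simp add: algebra_simps)
qed simp

lemma solve_contiguous: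
  assumes eq: "fps_const \<epsilon> * (fps_const (M + 1 - a) + fps_X) * (fps_const (M + 1 - b) + fps_X) * F =
      (fps_const M + fps_X) * (fps_const (M + 1 - c) + fps_X) * G + H"
    and \<epsilon>: "\<epsilon> * \<epsilon> = 1" and nz: "M + 1 - a \<noteq> 0" "M + 1 - b \<noteq> 0"
  shows "F = step_factor \<epsilon> a b c M * G + step_inhom \<epsilon> a b M * H"
proof -
  define p where "p = fps_const (M + 1 - a) + fps_X"
  define q where "q = fps_const (M + 1 - b) + fps_X"
  have p: "inverse p * p = 1" and q: "inverse q * q = 1"
    using nz by (auto simp: p_def q_def intro!: inverse_mult_eq_1)
  have e: "fps_const \<epsilon> * fps_const \<epsilon> = 1" using \<epsilon> by simp
  have "step_inhom \<epsilon> a b M * (fps_const \<epsilon> * p * q * F) =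
        (fps_const \<epsilon> * fps_const \<epsilon>) * (inverse p * p) * (inverse q * q) * F"
    unfolding step_inhom_def p_def[symmetric] q_def[symmetric] by (simp only: mult_ac)
  also have "\<dots> = F" unfolding p q e by simp
  finally show ?thesis
    unfolding p_def q_def eq step_factor_def by (simp add: algebra_simps)
qed

lemma pole_fps_contiguous:
  assumes \<epsilon>: "\<epsilon> = 1 \<or> \<epsilon> = -1" and c: "c \<notin> \<int>\<^sub>\<le>\<^sub>0"
    and r: "\<epsilon> = 1 \<Longrightarrow> Re (c - a - b) > -1" and M: "\<And>n. of_nat n + M \<noteq> 0"
    and sM: "\<And>s. summable (A0_term \<epsilon> (Suc s) M a b c)"
    and sM1: "\<And>s. summable (A0_term \<epsilon> (Suc s) (M - 1) a b c)"
    and nz: "M + 1 - a \<noteq> 0" "M + 1 - b \<noteq> 0"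
  shows "pole_fps \<epsilon> M a b c = step_factor \<epsilon> a b c M * pole_fps \<epsilon> (M - 1) a b c +
           step_inhom \<epsilon> a b M * E_fps \<epsilon> M a b c"
proof (rule solve_contiguous[OF _ _ nz])
  show "fps_const \<epsilon> * (fps_const (M + 1 - a) + fps_X) * (fps_const (M + 1 - b) + fps_X) * pole_fps \<epsilon> M a b c =
      (fps_const M + fps_X) * (fps_const (M + 1 - c) + fps_X) * pole_fps \<epsilon> (M - 1) a b c + E_fps \<epsilon> M a b c"
  proof (cases "\<epsilon> = 1")
    case True
    show ?thesis
      using pole_fps_contiguous_1[OF c r[OF True] M sM[unfolded True] sM1[unfolded True]]
      unfolding True E_fps_def if_P[OF refl] .
  next
    case False
    with \<epsilon> have e: "\<epsilon> = -1" by simp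
    have "(-1 :: complex) \<noteq> 1" by simp
    note E = if_not_P[OF this]
    show ?thesis
      using pole_fps_contiguous_minus_1[OF c M sM[unfolded e] sM1[unfolded e]]
      unfolding e E_fps_def E .
  qed
  show "\<epsilon> * \<epsilon> = 1" using \<epsilon> by auto
qed

lemma sum_antidiagonal:
  fixes f :: "nat \<Rightarrow> nat \<Rightarrow> 'a :: comm_monoid_add"
  shows "(\<Sum>(u, v) | u + v = n. f u v) = (\<Sum>i=0..n. f i (n - i))"
  by (rule sum.reindex_bij_witness[of _ "\<lambda>i. (i, n - i)" fst]) auto

text \<open>
  The coefficient of degree \<open>K - 1\<close> in the iterated relation. The sign \<open>(-1)\<^sup>K\<^sup>-\<^sup>1\<close> of the left-hand
  side is moved to the right, where it meets the signs \<open>(-1)\<^sup>K\<^sup>-\<^sup>1\<^sup>-\<^sup>s\<close> of the coefficients of \<open>F(\<lambda> + t)\<close>.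
\<close>
theorem shifted_pole_series:
  assumes K: "K \<ge> 1" and \<epsilon>: "\<epsilon> = 1 \<or> \<epsilon> = -1" and c: "c \<notin> \<int>\<^sub>\<le>\<^sub>0" and \<alpha>: "\<alpha> > -1"
    and lam: "lam = complex_of_real \<alpha>"
    and nz: "\<And>j. j \<in> {1..l} \<Longrightarrow> lam + of_nat j + 1 - a \<noteq> 0 \<and> lam + of_nat j + 1 - b \<noteq> 0"
    and r: "\<epsilon> = 1 \<Longrightarrow> Re (c - a - b) > -1"
    and s1: "summable (A0_term \<epsilon> 1 lam a b c)"
  shows "A0 \<epsilon> K (lam + of_nat l) a b c =
      (\<Sum>s = 0..K - 1. (-1) ^ s * r_coeff \<epsilon> a b c lam l s * A0 \<epsilon> (K - s) lam a b c)
       + (-1) ^ (K - 1) *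
         (\<Sum>j = 1..l. \<Sum>(u, v) | u + v = K - 1.
            t_coeff \<epsilon> a b c lam l j u * e_coeff \<epsilon> a b c lam j v)"
proof -
  define F where "F = (\<lambda>j. pole_fps \<epsilon> (lam + of_nat j) a b c)"
  define \<rho> where "\<rho> = (\<lambda>j. step_factor \<epsilon> a b c (lam + of_nat j))"
  define \<tau> where "\<tau> = (\<lambda>j. step_inhom \<epsilon> a b (lam + of_nat j))"
  define E where "E = (\<lambda>j. E_fps \<epsilon> (lam + of_nat j) a b c)"
  have sm: "summable (A0_term \<epsilon> (Suc s) (lam + of_nat j) a b c)" for s j
    using s1 \<alpha> unfolding lam by (rule summable_A0_term_shift)
  have "F (Suc j) = \<rho> (Suc j) * F j + \<tau> (Suc j) * E (Suc j)" if "j < l" for j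
  proof -
    have "complex_of_real (real n + (\<alpha> + real (Suc j))) \<noteq> 0" for n
      using \<alpha> by (subst of_real_eq_0_iff) simp
    hence M: "of_nat n + (lam + of_nat (Suc j)) \<noteq> 0" for n
      by (simp add: lam)
    have pred: "lam + of_nat (Suc j) - 1 = lam + of_nat j" by simp
    have "Suc j \<in> {1..l}" using that by simp
    hence "lam + of_nat (Suc j) + 1 - a \<noteq> 0" "lam + of_nat (Suc j) + 1 - b \<noteq> 0"
      using nz by blast+
    thus ?thesis
      unfolding F_def \<rho>_def \<tau>_def E_def pred[symmetric]
      by (intro pole_fps_contiguous \<epsilon> c r M sm) (simp_all only: pred sm simp_thms not_False_eq_True)
  qed
  hence "F l = (\<Prod>j=1..l. \<rho> j) * F 0 + (\<Sum>j=1..l. \<tau> j * (\<Prod>i=Suc j..l. \<rho> i) * E j)"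
    by (rule iterate_affine_recurrence)
  hence "fps_nth (F l) (K - 1) = fps_nth ((\<Prod>j=1..l. \<rho> j) * F 0) (K - 1) +
      (\<Sum>j=1..l. fps_nth (\<tau> j * (\<Prod>i=Suc j..l. \<rho> i) * E j) (K - 1))"
    by (simp add: fps_sum_nth)
  also have "fps_nth (F l) (K - 1) = (-1) ^ (K - 1) * A0 \<epsilon> K (lam + of_nat l) a b c"
    using K by (simp add: F_def pole_fps_def)
  also have "fps_nth ((\<Prod>j=1..l. \<rho> j) * F 0) (K - 1) =
      (\<Sum>s = 0..K - 1. r_coeff \<epsilon> a b c lam l s * ((-1) ^ (K - 1 - s) * A0 \<epsilon> (K - s) lam a b c))"
    unfolding fps_mult_nth
  proof (rule sum.cong)
    fix s assume s: "s \<in> {0..K - 1}"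
    have "fps_expansion (\<lambda>t. Rfun \<epsilon> a b c l (lam + t)) 0 = (\<Prod>j=1..l. \<rho> j)"
      unfolding \<rho>_def by (intro fps_expansion_eqI Rfun_has_fps_expansion nz)
    moreover have "Suc (K - 1 - s) = K - s" using s K by auto
    ultimately show "fps_nth (\<Prod>j=1..l. \<rho> j) s * fps_nth (F 0) (K - 1 - s) =
        r_coeff \<epsilon> a b c lam l s * ((-1) ^ (K - 1 - s) * A0 \<epsilon> (K - s) lam a b c)"
      unfolding r_coeff_def taylor_coeff_def F_def pole_fps_def by simp
  qed simp
  also have "(\<Sum>j=1..l. fps_nth (\<tau> j * (\<Prod>i=Suc j..l. \<rho> i) * E j) (K - 1)) =
       (\<Sum>j = 1..l. \<Sum>(u, v) | u + v = K - 1.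
            t_coeff \<epsilon> a b c lam l j u * e_coeff \<epsilon> a b c lam j v)"
  proof (rule sum.cong)
    fix j assume j: "j \<in> {1..l}"
    have "fps_expansion (\<lambda>t. Tfun \<epsilon> a b c l j (lam + t)) 0 = \<tau> j * (\<Prod>i=Suc j..l. \<rho> i)"
      unfolding \<rho>_def \<tau>_def using j by (intro fps_expansion_eqI Tfun_has_fps_expansion nz) auto
    moreover have "fps_expansion (\<lambda>t. E_eps \<epsilon> (of_nat j + lam + t) a b c) 0 = E j"
      unfolding E_def using E_eps_has_fps_expansion[of \<epsilon> "lam + of_nat j" a b c]
      by (intro fps_expansion_eqI) (simp add: add.commute)
    ultimately show "fps_nth (\<tau> j * (\<Prod>i=Suc j..l. \<rho> i) * E j) (K - 1) =
        (\<Sum>(u, v) | u + v = K - 1. t_coeff \<epsilon> a b c lam l j u * e_coeff \<epsilon> a b c lam j v)"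
      unfolding sum_antidiagonal fps_mult_nth[of _ "E j"] t_coeff_def e_coeff_def taylor_coeff_def
      by simp
  qed simp
  finally have "(-1) ^ (K - 1) * ((-1) ^ (K - 1) * A0 \<epsilon> K (lam + of_nat l) a b c) =
      (-1) ^ (K - 1) * (\<Sum>s = 0..K - 1. r_coeff \<epsilon> a b c lam l s * ((-1) ^ (K - 1 - s) * A0 \<epsilon> (K - s) lam a b c))
      + (-1) ^ (K - 1) * (\<Sum>j = 1..l. \<Sum>(u, v) | u + v = K - 1.
            t_coeff \<epsilon> a b c lam l j u * e_coeff \<epsilon> a b c lam j v)"
    by (simp only: distrib_left)
  also have "(-1) ^ (K - 1) * (\<Sum>s = 0..K - 1. r_coeff \<epsilon> a b c lam l s * ((-1) ^ (K - 1 - s) * A0 \<epsilon> (K - s) lam a b c))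
     = (\<Sum>s = 0..K - 1. (-1) ^ s * r_coeff \<epsilon> a b c lam l s * A0 \<epsilon> (K - s) lam a b c)"
    unfolding sum_distrib_left
  proof (rule sum.cong)
    fix s assume s: "s \<in> {0..K - 1}"
    have "K - 1 = s + (K - 1 - s)" using s by simp
    hence "(-1 :: complex) ^ (K - 1) = (-1) ^ s * (-1) ^ (K - 1 - s)"
      by (metis power_add)
    moreover have "(-1 :: complex) ^ (K - 1 - s) * (-1) ^ (K - 1 - s) = 1"
      by (simp flip: power_mult_distrib)
    moreover have "u = v * w \<Longrightarrow> w * w = 1 \<Longrightarrow> u * (x * (w * y)) = v * x * y"
      for u v w x y :: complex by algebra
    ultimately show "(-1) ^ (K - 1) * (r_coeff \<epsilon> a b c lam l s * ((-1) ^ (K - 1 - s) * A0 \<epsilon> (K - s) lam a b c))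
       = (-1) ^ s * r_coeff \<epsilon> a b c lam l s * A0 \<epsilon> (K - s) lam a b c"
      by blast
  qed simp
  finally show ?thesis
    by (simp add: mult.assoc[symmetric] flip: power_mult_distrib)
qed

theorem theorem2p7:
  fixes d m K l \<rho> :: nat and \<epsilon> a b c lam :: complex
  assumes "d \<ge> 1" and "K \<ge> 1"
    and "\<epsilon> \<in> {1, -1}"
    and "c \<notin> \<int>\<^sub>\<le>\<^sub>0"
    and "m = d * l + \<rho>" and "\<rho> \<le> d - 1"
    and "lam = (of_nat \<rho> + 1) / of_nat d - 1"
    and "\<forall>j\<in>{1..l}. of_nat j + lam + 1 - a \<noteq> 0 \<and> of_nat j + lam + 1 - b \<noteq> 0"
    and "\<epsilon> = 1 \<longrightarrow> Re (c - a - b) > -1"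
    and "\<epsilon> = -1 \<longrightarrow>
           summable (\<lambda>n. \<epsilon> ^ n * hyp_coeff a b c n / of_nat (d * n + m + 1) ^ K) \<and>
           (\<forall>k\<in>{1..K}. summable (A0_term \<epsilon> k lam a b c))"
  shows "(\<forall>k\<in>{1..K}. summable (A0_term \<epsilon> k lam a b c)) \<and>
    (\<lambda>n. \<epsilon> ^ n * hyp_coeff a b c n / of_nat (d * n + m + 1) ^ K) sums
      (1 / of_nat d ^ K *
         (\<Sum>s = 0..K - 1. (-1) ^ s * r_coeff \<epsilon> a b c lam l s * A0 \<epsilon> (K - s) lam a b c)
       + (-1) ^ (K - 1) / of_nat d ^ K *
         (\<Sum>j = 1..l. \<Sum>(u, v) | u + v = K - 1.
            t_coeff \<epsilon> a b c lam l j u * e_coeff \<epsilon> a b c lam j v)) \<and>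
    (d = 1 \<longrightarrow> lam = 0 \<and>
       Am \<epsilon> K m a b c =
         (\<Sum>s = 0..K - 1. (-1) ^ s * r_coeff \<epsilon> a b c 0 m s * A0 \<epsilon> (K - s) 0 a b c)
         + (-1) ^ (K - 1) *
         (\<Sum>j = 1..m. \<Sum>(u, v) | u + v = K - 1.
            t_coeff \<epsilon> a b c 0 m j u * e_coeff \<epsilon> a b c 0 j v))"
proof -
  \<comment> \<open>The shift is real and exceeds \<open>-1\<close>, so no denominator vanishes.\<close>
  define \<alpha> where "\<alpha> = (real \<rho> + 1) / real d - 1"
  have lam: "lam = complex_of_real \<alpha>" using assms(7) by (simp add: \<alpha>_def)
  have \<alpha>: "\<alpha> > -1" using \<open>d \<ge> 1\<close> by (simp add: \<alpha>_def)
  have \<epsilon>: "\<epsilon> = 1 \<or> \<epsilon> = -1" using assms(3) by auto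
  have r: "Re (c - a - b) > -1" if "\<epsilon> = 1" using assms(9) that by blast
  have s1: "summable (A0_term \<epsilon> 1 lam a b c)"
  proof (cases "\<epsilon> = 1")
    case True
    show ?thesis using summable_A0_term_1[OF assms(4) r[OF True] \<alpha>] unfolding True lam .
  next
    case False
    thus ?thesis using \<epsilon> assms(10) \<open>K \<ge> 1\<close> by simp
  qed
  have sm: "summable (A0_term \<epsilon> (Suc s) (lam + of_nat j) a b c)" for s j
    using s1 \<alpha> unfolding lam by (rule summable_A0_term_shift)
  have nz: "lam + of_nat j + 1 - a \<noteq> 0 \<and> lam + of_nat j + 1 - b \<noteq> 0" if "j \<in> {1..l}" for j
    using assms(8) that by (simp add: add.commute)
  let ?R = "(\<Sum>s = 0..K - 1. (-1) ^ s * r_coeff \<epsilon> a b c lam l s * A0 \<epsilon> (K - s) lam a b c)"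
  let ?T = "(\<Sum>j = 1..l. \<Sum>(u, v) | u + v = K - 1. t_coeff \<epsilon> a b c lam l j u * e_coeff \<epsilon> a b c lam j v)"
  have main: "A0 \<epsilon> K (lam + of_nat l) a b c = ?R + (-1) ^ (K - 1) * ?T"
    by (rule shifted_pole_series[OF \<open>K \<ge> 1\<close> \<epsilon> assms(4) \<alpha> lam nz r s1])
  have summ: "\<forall>k\<in>{1..K}. summable (A0_term \<epsilon> k lam a b c)"
  proof
    fix k assume "k \<in> {1..K}"
    thus "summable (A0_term \<epsilon> k lam a b c)" using sm[of "k - 1" 0] by simp
  qed
  have "A0_term \<epsilon> K (lam + of_nat l) a b c sums (?R + (-1) ^ (K - 1) * ?T)"
    unfolding main[symmetric] unfolding A0_def using sm[of "K - 1" l] \<open>K \<ge> 1\<close> by (simp add: summable_sums)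
  hence "(\<lambda>n. 1 / of_nat d ^ K * A0_term \<epsilon> K (lam + of_nat l) a b c n) sums
     (1 / of_nat d ^ K * (?R + (-1) ^ (K - 1) * ?T))"
    by (rule sums_mult)
  moreover have "1 / of_nat d ^ K * A0_term \<epsilon> K (lam + of_nat l) a b c n =
      \<epsilon> ^ n * hyp_coeff a b c n / of_nat (d * n + m + 1) ^ K" for n
  proof -
    have "of_nat d * (of_nat n + 1 + (lam + of_nat l)) = (of_nat (d * n + m + 1) :: complex)"
    proof -
      have "(of_nat d :: complex) \<noteq> 0" using \<open>d \<ge> 1\<close> by simp
      hence "of_nat d * (1 + lam) = of_nat \<rho> + 1" by (simp add: assms(7))
      thus ?thesis unfolding assms(5) by (simp add: algebra_simps)
    qed
    thus ?thesis unfolding A0_term_def by (simp flip: power_mult_distrib)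
  qed
  moreover have "1 / of_nat d ^ K * (?R + (-1) ^ (K - 1) * ?T) =
      1 / of_nat d ^ K * ?R + (-1) ^ (K - 1) / of_nat d ^ K * ?T"
    by (simp add: distrib_left)
  ultimately have sums: "(\<lambda>n. \<epsilon> ^ n * hyp_coeff a b c n / of_nat (d * n + m + 1) ^ K) sums
      (1 / of_nat d ^ K * ?R + (-1) ^ (K - 1) / of_nat d ^ K * ?T)"
    by simp
  have "lam = 0 \<and> Am \<epsilon> K m a b c =
         (\<Sum>s = 0..K - 1. (-1) ^ s * r_coeff \<epsilon> a b c 0 m s * A0 \<epsilon> (K - s) 0 a b c)
         + (-1) ^ (K - 1) *
         (\<Sum>j = 1..m. \<Sum>(u, v) | u + v = K - 1.
            t_coeff \<epsilon> a b c 0 m j u * e_coeff \<epsilon> a b c 0 j v)" if d: "d = 1"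
  proof
    have \<rho>: "\<rho> = 0" and ml: "m = l" using assms(5,6) d by auto
    show l0: "lam = 0" using assms(7) d \<rho> by simp
    have "A0 \<epsilon> K (lam + of_nat l) a b c = Am \<epsilon> K m a b c"
      unfolding A0_def Am_def A0_term_def l0 ml by (simp add: add_ac)
    with main show "Am \<epsilon> K m a b c =
         (\<Sum>s = 0..K - 1. (-1) ^ s * r_coeff \<epsilon> a b c 0 m s * A0 \<epsilon> (K - s) 0 a b c)
         + (-1) ^ (K - 1) *
         (\<Sum>j = 1..m. \<Sum>(u, v) | u + v = K - 1.
            t_coeff \<epsilon> a b c 0 m j u * e_coeff \<epsilon> a b c 0 j v)"
      unfolding l0 ml by simp
  qed
  with summ sums show ?thesis by blast
qed

end
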